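(* Let $a,d$ be natural numbers with $1\le a<d$ and $(a,d)=1$. Then there are infinitely many primes of the form $a+md$ with $m\ge 1$ a natural number.
   Context: $(a,d)$ denotes the greatest common divisor of $a$ and $d$. *)

theory Defs
  imports "HOL-Computational_Algebra.Primes"
begin

end

theory Submission
  imports Defs
    "HOL-Analysis.Derivative" "HOL-Analysis.Infinite_Sum" "HOL-Analysis.Summation_Tests"
    "HOL-Number_Theory.Number_Theory" "HOL-Library.Landau_Symbols"
begin

text \<open>
  Dirichlet's theorem on primes in arithmetic progressions. For a function \<open>f\<close> on the residues modulo
  \<open>d\<close> that vanishes outside the units, consider the von Mangoldt series
  \<open>A\<^sub>f(s) = \<Sum>n. f n * mangoldt n * n powr - s\<close> for real \<open>s > 1\<close>. The heart of the matter is
  \<open>mangoldt_series_residue_function\<close>: as \<open>s \<rightarrow> 1\<close>, the series \<open>A\<^sub>f\<close> differs by a bounded amount from the mean of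
  \<open>f\<close> times the series \<open>A\<^sub>0\<close> of the principal character, and \<open>A\<^sub>0\<close> is unbounded. If \<open>f\<close> is the indicator function
  of the class of \<open>a\<close>, then the mean is not zero, so \<open>A\<^sub>f\<close> is unbounded; but if the class contained only
  finitely many primes, then \<open>A\<^sub>f\<close> would be bounded, because the proper prime powers contribute only
  a bounded amount.

  The asymptotic statement is linear in \<open>f\<close>, and the characters span the residue functions
  (\<open>residue_function_induct\<close>, by simultaneous diagonalisation of the translations of the unit group), so \<open>f\<close>
  may be taken to be a character \<open>\<chi>\<close>. For a nonprincipal one, \<open>A\<^sub>\<chi> = - L' / L\<close>, where \<open>L'\<close> is bounded near 1
  by summation by parts, and it remains to know that \<open>L(1, \<chi>) \<noteq> 0\<close>.

  If \<open>\<chi>\<^sup>2\<close> is not principal, this follows from the inequality \<open>3 + 4 cos \<phi> + cos 2\<phi> \<ge> 0\<close>, in the same way as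
  the zeta function is shown to have no zeros on the line of real part 1. If \<open>\<chi>\<close> is real, it
  follows from comparing two expressions for the Lambert series \<open>\<Sum>m. \<chi> m * t ^ m / (1 - t ^ m)\<close> as \<open>t \<rightarrow> 1\<close>:
  as a power series it has nonnegative coefficients and is unbounded, but it would be bounded if
  \<open>L(1, \<chi>)\<close> were zero. No complex values of \<open>s\<close> and no analytic continuation enter.
\<close>

unbundle no vec_syntax

section \<open>Dirichlet characters and residue functions\<close>

definition residue_function :: "nat \<Rightarrow> (nat \<Rightarrow> complex) \<Rightarrow> bool" where
  "residue_function d f \<longleftrightarrow> (\<forall>n. f (n mod d) = f n) \<and> (\<forall>n. \<not> coprime n d \<longrightarrow> f n = 0)"

text \<open>
  A homomorphism from the unit group modulo \<open>d\<close> to the nonzero complex numbers, extended by zero to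
  a completely multiplicative function on the naturals.
\<close>

definition dirichlet_char :: "nat \<Rightarrow> (nat \<Rightarrow> complex) \<Rightarrow> bool" where
  "dirichlet_char d \<chi> \<longleftrightarrow>
     (\<forall>m n. \<chi> (m * n) = \<chi> m * \<chi> n) \<and> (\<forall>n. \<chi> (n mod d) = \<chi> n) \<and> (\<forall>n. \<chi> n = 0 \<longleftrightarrow> \<not> coprime n d)"

definition principal_char :: "nat \<Rightarrow> nat \<Rightarrow> complex" where
  "principal_char d n = (if coprime n d then 1 else 0)"

lemma dirichlet_char_mult: "dirichlet_char d \<chi> \<Longrightarrow> \<chi> (m * n) = \<chi> m * \<chi> n"
  and dirichlet_char_mod: "dirichlet_char d \<chi> \<Longrightarrow> \<chi> (n mod d) = \<chi> n"
  and dirichlet_char_eq_0_iff: "dirichlet_char d \<chi> \<Longrightarrow> \<chi> n = 0 \<longleftrightarrow> \<not> coprime n d"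
  by (simp_all add: dirichlet_char_def)

lemma dirichlet_char_1: "dirichlet_char d \<chi> \<Longrightarrow> \<chi> 1 = 1"
  using dirichlet_char_mult[of d \<chi> 1 1] dirichlet_char_eq_0_iff[of d \<chi> 1] by simp

lemma dirichlet_char_power: "dirichlet_char d \<chi> \<Longrightarrow> \<chi> (n ^ k) = \<chi> n ^ k"
  by (induction k) (simp_all add: dirichlet_char_1[simplified] dirichlet_char_mult)

lemma dirichlet_char_principal: "dirichlet_char d (principal_char d)"
  by (cases "d = 0") (auto simp: dirichlet_char_def principal_char_def)

lemma dirichlet_char_times:
  "dirichlet_char d \<chi> \<Longrightarrow> dirichlet_char d \<psi> \<Longrightarrow> dirichlet_char d (\<lambda>n. \<chi> n * \<psi> n)"
  by (auto simp: dirichlet_char_def)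

text \<open>
  By Euler's theorem a nonzero value is a root of unity.
\<close>

lemma norm_dirichlet_char:
  assumes "dirichlet_char d \<chi>" and "d > 0"
  shows "norm (\<chi> n) = (if coprime n d then 1 else 0)"
proof (cases "coprime n d")
  case True
  have "\<chi> n ^ totient d = \<chi> (n ^ totient d mod d)"
    using assms by (simp add: dirichlet_char_power dirichlet_char_mod)
  also have "\<dots> = \<chi> 1"
    using euler_theorem[OF True] dirichlet_char_mod[OF assms(1)] unfolding cong_def by metis
  finally have "\<chi> n ^ totient d = 1"
    using dirichlet_char_1[OF assms(1)] by simp
  hence "norm (\<chi> n) = 1"
    using assms(2) power_eq_1_iff[of "\<chi> n" "totient d"] by auto
  with True show ?thesis by simp
qed (use assms in \<open>simp add: dirichlet_char_eq_0_iff\<close>)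

lemma norm_dirichlet_char_le_1:
  assumes "dirichlet_char d \<chi>" and "d > 0"
  shows "norm (\<chi> n) \<le> 1"
  using norm_dirichlet_char[OF assms] by simp

text \<open>
  Multiplication by a unit \<open>g\<close> with \<open>\<chi> g \<noteq> 1\<close> permutes the residues, hence multiplies the sum by
  \<open>\<chi> g\<close> without changing it.
\<close>

lemma sum_dirichlet_char_period:
  assumes "dirichlet_char d \<chi>" and "d > 0" and "\<chi> \<noteq> principal_char d"
  shows "(\<Sum>n<d. \<chi> n) = 0"
proof -
  obtain g where g: "\<chi> g \<noteq> principal_char d g"
    using assms(3) by auto
  hence cop: "coprime g d" and "\<chi> g \<noteq> 1"
    using dirichlet_char_eq_0_iff[OF assms(1), of g]
    by (auto simp: principal_char_def split: if_splits)
  have inj: "inj_on (\<lambda>n. g * n mod d) {..<d}"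
  proof (rule inj_onI)
    fix m n assume "m \<in> {..<d}" "n \<in> {..<d}" "g * m mod d = g * n mod d"
    thus "m = n"
      using cop cong_mult_lcancel_nat[of g d m n] by (auto simp: cong_def)
  qed
  have "(\<lambda>n. g * n mod d) ` {..<d} = {..<d}"
    by (rule endo_inj_surj) (use inj assms(2) in auto)
  hence "bij_betw (\<lambda>n. g * n mod d) {..<d} {..<d}"
    using inj by (simp add: bij_betw_def)
  hence "(\<Sum>n<d. \<chi> n) = (\<Sum>n<d. \<chi> (g * n mod d))"
    by (rule sum.reindex_bij_betw [symmetric])
  also have "\<dots> = \<chi> g * (\<Sum>n<d. \<chi> n)"
    using assms(1) by (simp add: dirichlet_char_mod dirichlet_char_mult sum_distrib_left)
  finally show ?thesis using \<open>\<chi> g \<noteq> 1\<close> by simp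
qed

text \<open>
  For \<open>0 < k < N\<close> there are fewer \<open>k\<close>-th than \<open>N\<close>-th roots of unity, so some \<open>N\<close>-th root \<open>w\<close> has
  \<open>w ^ k \<noteq> 1\<close>; replacing \<open>z\<close> by \<open>w * z\<close> shows that the sum vanishes.
\<close>

lemma sum_powers_roots_of_unity:
  assumes "k < N"
  shows "(\<Sum>z | z ^ N = 1. z ^ k :: complex) = (if k = 0 then of_nat N else 0)"
proof (cases "k = 0")
  case True
  with assms show ?thesis by (simp add: card_roots_unity_eq)
next
  case False
  have "card {z::complex. z ^ k = 1} < card {z::complex. z ^ N = 1}"
    using False assms by (simp add: card_roots_unity_eq)
  moreover have "finite {z::complex. z ^ k = 1}" using False by (intro finite_nth_roots) auto
  ultimately obtain w :: complex where w: "w ^ N = 1" "w ^ k \<noteq> 1"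
    using card_mono[of "{z::complex. z ^ k = 1}" "{z::complex. z ^ N = 1}"] by fastforce
  hence "w \<noteq> 0" using assms by (auto simp: zero_power)
  have "(\<Sum>z | z ^ N = 1. z ^ k) = (\<Sum>z | z ^ N = 1. (w * z) ^ k)"
    by (rule sum.reindex_bij_witness[of _ "\<lambda>z. w * z" "\<lambda>z. z / w"])
       (use w \<open>w \<noteq> 0\<close> in \<open>auto simp: power_mult_distrib power_divide\<close>)
  also have "\<dots> = w ^ k * (\<Sum>z | z ^ N = 1. z ^ k)"
    by (simp add: power_mult_distrib sum_distrib_left)
  finally show ?thesis using w False by simp
qed

definition translation_eigen :: "(nat \<Rightarrow> complex) \<Rightarrow> nat \<Rightarrow> bool" where
  "translation_eigen f g \<longleftrightarrow> (\<exists>c. \<forall>n. f (g * n) = c * f n)"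

text \<open>
  A simultaneous eigenfunction of all translations vanishes identically if \<open>f 1 = 0\<close>. Otherwise the
  eigenvalue of the translation by \<open>g\<close> is forced to be \<open>f g / f 1\<close>, and since eigenvalues are
  multiplicative in \<open>g\<close>, this is a character.
\<close>

lemma translation_eigen_imp_char:
  assumes f: "residue_function d f" and d: "d > 1"
    and eigen: "\<And>g. g < d \<Longrightarrow> coprime g d \<Longrightarrow> translation_eigen f g"
  shows "\<exists>c \<chi>. dirichlet_char d \<chi> \<and> f = (\<lambda>n. c * \<chi> n)"
proof -
  have mult: "f (m * n) * f 1 = f m * f n" if "coprime m d" for m n
  proof -
    have "translation_eigen f (m mod d)" using that d by (intro eigen) auto
    then obtain c where c: "f (m mod d * k) = c * f k" for k unfolding translation_eigen_def by blast
    have "f (m mod d * k) = f (m * k)" for k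
      using f unfolding residue_function_def by (metis mod_mult_left_eq)
    hence "f (m * k) = c * f k" for k using c by simp
    from this[of n] this[of 1] show ?thesis by simp
  qed
  have zero: "f n = 0" if "\<not> coprime n d" for n
    using that f by (simp add: residue_function_def)
  show ?thesis
  proof (cases "f 1 = 0")
    case True
    have "f n = 0" for n
      using mult[of n n] zero[of n] True by (cases "coprime n d") auto
    thus ?thesis
      by (intro exI[of _ 0] exI[of _ "principal_char d"]) (auto simp: dirichlet_char_principal)
  next
    case False
    define \<chi> where "\<chi> = (\<lambda>n. f n / f 1)"
    have nz: "f n \<noteq> 0" if "coprime n d" for n
    proof
      assume "f n = 0"
      obtain m where "[n * m = 1] (mod d)"
        using cong_solve_coprime_nat[OF \<open>coprime n d\<close>] unfolding One_nat_def by blast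
      hence "f (n * m) = f 1"
        using f unfolding residue_function_def cong_def by metis
      moreover have "f (n * m) * f 1 = 0" using mult[OF that, of m] \<open>f n = 0\<close> by simp
      ultimately show False using False by simp
    qed
    have "\<chi> (m * n) = \<chi> m * \<chi> n" for m n
      using mult[of m n] zero[of m] zero[of "m * n"] False
      by (cases "coprime m d") (auto simp: \<chi>_def field_simps)
    hence "dirichlet_char d \<chi>"
      using f nz zero False unfolding dirichlet_char_def residue_function_def \<chi>_def by auto
    thus ?thesis using False by (intro exI[of _ "f 1"] exI[of _ \<chi>]) (auto simp: \<chi>_def)
  qed
qed

lemma residue_function_power_totient:
  assumes "residue_function d f" and "coprime h d"
  shows "f (h ^ totient d * n) = f n"
  using assms euler_theorem[of h d] unfolding residue_function_def cong_def
  by (metis mod_mult_left_eq mult_1)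

text \<open>
  For \<open>N = totient d\<close> the \<open>N\<close>-th power of the translation by a unit \<open>h\<close> is the identity; averaging
  over its powers with weights \<open>z ^ k\<close> projects onto its eigenspace for the eigenvalue
  \<open>inverse z\<close>, for every \<open>N\<close>-th root of unity \<open>z\<close>.
\<close>

definition translation_projection :: "nat \<Rightarrow> nat \<Rightarrow> complex \<Rightarrow> (nat \<Rightarrow> complex) \<Rightarrow> nat \<Rightarrow> complex" where
  "translation_projection N h z f n = (\<Sum>k<N. z ^ k * f (h ^ k * n)) / of_nat N"

lemma translation_projection_residue_function:
  assumes "residue_function d f" and "coprime h d"
  shows "residue_function d (translation_projection N h z f)"
  unfolding residue_function_def
proof safe
  fix n
  have "f (h ^ k * (n mod d)) = f (h ^ k * n)" for k
    using assms(1) unfolding residue_function_def by (metis mod_mult_right_eq)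
  thus "translation_projection N h z f (n mod d) = translation_projection N h z f n"
    by (simp add: translation_projection_def)
next
  fix n assume "\<not> coprime n d"
  hence "f (h ^ k * n) = 0" for k
    using assms(1) unfolding residue_function_def by auto
  thus "translation_projection N h z f n = 0"
    by (simp add: translation_projection_def)
qed

lemma translation_projection_eigen:
  assumes f: "residue_function d f" and h: "coprime h d" and z: "z ^ totient d = 1" and d: "d > 0"
  shows "translation_eigen (translation_projection (totient d) h z f) h"
proof -
  let ?N = "totient d"
  have z0: "z \<noteq> 0" using z d by (auto simp: zero_power)
  have "z * (\<Sum>k<?N. z ^ k * f (h ^ k * (h * n))) = (\<Sum>k<?N. z ^ k * f (h ^ k * n))" for n
  proof -
    define u where "u k = z ^ k * f (h ^ k * n)" for k
    have "u ?N = u 0" using z residue_function_power_totient[OF f h] by (simp add: u_def)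
    moreover have "(\<Sum>k<?N. u (Suc k)) + u 0 = (\<Sum>k<?N. u k) + u ?N"
      using sum.lessThan_Suc_shift[of u ?N] sum.lessThan_Suc[of u ?N] by (simp add: add.commute)
    moreover have "z * (\<Sum>k<?N. z ^ k * f (h ^ k * (h * n))) = (\<Sum>k<?N. u (Suc k))"
      by (simp add: u_def sum_distrib_left mult_ac)
    ultimately show ?thesis by (simp add: u_def)
  qed
  hence "translation_projection ?N h z f (h * n) = inverse z * translation_projection ?N h z f n" for n
    using z0 unfolding translation_projection_def
    by (metis (no_types, lifting) left_inverse mult.assoc mult_1_left times_divide_eq_right)
  thus ?thesis unfolding translation_eigen_def by blast
qed

text \<open>
  Translations commute, so projecting for one of them does not destroy what was achieved for others.
\<close>

lemma translation_projection_preserves_eigen: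
  assumes "translation_eigen f g"
  shows "translation_eigen (translation_projection N h z f) g"
proof -
  obtain c where c: "f (g * n) = c * f n" for n
    using assms unfolding translation_eigen_def by blast
  have *: "f (h ^ k * (g * n)) = c * f (h ^ k * n)" for k n
    using c[of "h ^ k * n"] by (simp add: mult_ac)
  have "translation_projection N h z f (g * n) = c * translation_projection N h z f n" for n
    unfolding translation_projection_def * by (simp add: sum_distrib_left mult_ac)
  thus ?thesis unfolding translation_eigen_def by blast
qed

lemma sum_translation_projections:
  assumes "N > 0"
  shows "(\<Sum>z | z ^ N = 1. translation_projection N h z f n) = f n"
proof -
  have "(\<Sum>z | z ^ N = 1. \<Sum>k<N. z ^ k * f (h ^ k * n)) =
        (\<Sum>k<N. (\<Sum>z | z ^ N = 1. z ^ k) * f (h ^ k * n))"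
    by (subst sum.swap) (simp add: sum_distrib_right)
  also have "\<dots> = (\<Sum>k<N. if k = 0 then of_nat N * f n else 0)"
    by (intro sum.cong refl) (simp add: sum_powers_roots_of_unity)
  also have "\<dots> = of_nat N * f n" using assms by (simp add: sum.delta)
  finally show ?thesis
    using assms by (simp add: translation_projection_def sum_divide_distrib [symmetric])
qed

text \<open>
  This is the statement that the characters span the space of residue functions, in the form in
  which it is used: a property that is stable under addition and holds for multiples of characters
  holds for every residue function. It is proved by diagonalising the translations one after the
  other. The set \<open>S\<close> in the proof contains the residues whose translations are yet to be
  diagonalised; each \<open>h\<close> in it is removed by splitting the function into its projections to
  the eigenspaces of the translation by \<open>h\<close>.
\<close>

theorem residue_function_induct [consumes 2, case_names add char]:
  assumes f: "residue_function d f" and d: "d > 1"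
    and add: "\<And>f g. Q f \<Longrightarrow> Q g \<Longrightarrow> Q (\<lambda>n. f n + g n)"
    and char: "\<And>c \<chi>. dirichlet_char d \<chi> \<Longrightarrow> Q (\<lambda>n. c * \<chi> n)"
  shows "Q f"
proof -
  have Q_sum: "Q (\<lambda>n. \<Sum>x\<in>A. F x n)" if "finite A" "\<And>x. x \<in> A \<Longrightarrow> Q (F x)"
    for A :: "complex set" and F
    using that
  proof (induction A rule: finite_induct)
    case empty
    show ?case using char[OF dirichlet_char_principal, of 0] by simp
  next
    case (insert x A)
    thus ?case using add[of "F x" "\<lambda>n. \<Sum>x\<in>A. F x n"] by simp
  qed
  have main: "Q f" if "finite S" "residue_function d f"
      "\<And>g. g < d \<Longrightarrow> coprime g d \<Longrightarrow> g \<notin> S \<Longrightarrow> translation_eigen f g" for S f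
    using that
  proof (induction S arbitrary: f rule: finite_induct)
    case empty
    then obtain c \<chi> where "dirichlet_char d \<chi>" "f = (\<lambda>n. c * \<chi> n)"
      using translation_eigen_imp_char[of d f] d by auto
    thus ?case using char by simp
  next
    case (insert h S)
    show ?case
    proof (cases "h < d \<and> coprime h d")
      case False
      thus ?thesis using insert.prems by (intro insert.IH) auto
    next
      case True
      let ?N = "totient d"
      have "?N > 0" using d by simp
      have "Q (\<lambda>n. \<Sum>z | z ^ ?N = 1. translation_projection ?N h z f n)"
      proof (rule Q_sum)
        show "finite {z::complex. z ^ ?N = 1}" using \<open>?N > 0\<close> by (intro finite_nth_roots)
      next
        fix z :: complex assume "z \<in> {z. z ^ ?N = 1}"
        hence z: "z ^ ?N = 1" by simp
        show "Q (translation_projection ?N h z f)"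
        proof (rule insert.IH)
          show "residue_function d (translation_projection ?N h z f)"
            using insert.prems True by (intro translation_projection_residue_function) auto
        next
          fix g assume "g < d" "coprime g d" "g \<notin> S"
          thus "translation_eigen (translation_projection ?N h z f) g"
            using translation_projection_eigen[of d f h z] translation_projection_preserves_eigen
              insert.prems True z d by (cases "g = h") auto
        qed
      qed
      thus ?thesis using sum_translation_projections[OF \<open>?N > 0\<close>] by simp
    qed
  qed
  show ?thesis by (rule main[of "{..<d}"]) (use f in auto)
qed

section \<open>Dirichlet series for real arguments\<close>

text \<open>
  Only real \<open>s\<close> are needed, since everything happens in the limit \<open>s \<rightarrow> 1\<close> from the right. The
  summand with index 0 is zero because \<open>0 powr x = 0\<close>.
\<close>

definition dirichlet_series :: "(nat \<Rightarrow> complex) \<Rightarrow> real \<Rightarrow> complex" where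
  "dirichlet_series a s = (\<Sum>n. a n * of_real (real n powr - s))"

lemma summable_ln_powr:
  assumes "s > (1::real)"
  shows "summable (\<lambda>n. ln (real n) * real n powr - s)"
proof -
  \<comment> \<open>half of the room between \<open>s\<close> and 1 absorbs the logarithm: \<open>ln n \<le> n powr e / e\<close>\<close>
  define e where "e = (s - 1) / 2"
  have e: "e > 0" "e - s < - 1" using assms by (simp_all add: e_def field_simps)
  have "norm (ln (real n) * real n powr - s) \<le> real n powr (e - s) / e" for n
  proof (cases "n = 0")
    case False
    hence "ln (real n) * real n powr - s \<le> real n powr e / e * real n powr - s"
      using e by (intro mult_right_mono ln_powr_bound) auto
    also have "\<dots> = real n powr (e - s) / e" by (simp add: powr_diff powr_minus divide_simps)
    finally show ?thesis using False by (simp add: abs_mult)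
  qed (use e in auto)
  moreover have "summable (\<lambda>n. real n powr (e - s) / e)"
    using e by (intro summable_divide) (simp add: summable_real_powr_iff)
  ultimately show ?thesis
    using summable_comparison_test'[of "\<lambda>n. real n powr (e - s) / e" 0
            "\<lambda>n. ln (real n) * real n powr - s"] by blast
qed

lemma summable_log_bounded_coeffs:
  fixes a :: "nat \<Rightarrow> complex"
  assumes "\<And>n. norm (a n) \<le> C * (1 + ln (real n))" and "s > 1"
  shows "summable (\<lambda>n. norm (a n * of_real (real n powr - s)))"
proof (rule summable_comparison_test')
  have "summable (\<lambda>n. real n powr - s)"
    using assms(2) by (simp add: summable_real_powr_iff)
  thus "summable (\<lambda>n. C * (real n powr - s + ln (real n) * real n powr - s))"
    using summable_ln_powr[OF assms(2)] by (rule summable_mult[OF summable_add])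
next
  fix n
  have "norm (a n) * real n powr - s \<le> C * (1 + ln (real n)) * real n powr - s"
    by (intro mult_right_mono assms) auto
  thus "norm (norm (a n * of_real (real n powr - s)))
          \<le> C * (real n powr - s + ln (real n) * real n powr - s)"
    by (simp add: norm_mult algebra_simps)
qed

lemma summable_bounded_coeffs:
  fixes a :: "nat \<Rightarrow> complex"
  assumes "\<And>n. norm (a n) \<le> 1" and "s > 1"
  shows "summable (\<lambda>n. norm (a n * of_real (real n powr - s)))"
proof (rule summable_log_bounded_coeffs[OF _ assms(2)])
  show "norm (a n) \<le> 1 * (1 + ln (real n))" for n
    using assms(1)[of n] by (cases "n = 0") (auto intro: add_increasing2)
qed

lemma summable_ln_coeffs:
  fixes a :: "nat \<Rightarrow> complex"
  assumes "\<And>n. norm (a n) \<le> 1" and "s > 1"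
  shows "summable (\<lambda>n. a n * of_real (ln (real n)) * of_real (real n powr - s))"
proof (rule summable_norm_cancel[OF summable_log_bounded_coeffs[OF _ assms(2)]])
  show "norm (a n * of_real (ln (real n))) \<le> 1 * (1 + ln (real n))" for n
    using mult_right_mono[OF assms(1)[of n], of "ln (real n)"]
    by (cases "n = 0") (auto simp: norm_mult)
qed

lemma norm_dirichlet_series_le:
  assumes "\<And>n. norm (a n) \<le> b n"
    and "summable (\<lambda>n. b n * real n powr - s)"
  shows "norm (dirichlet_series a s) \<le> (\<Sum>n. b n * real n powr - s)"
  unfolding dirichlet_series_def
  by (rule norm_suminf_le) (use assms in \<open>auto simp: norm_mult intro: mult_right_mono\<close>)

text \<open>
  Collecting the pairs \<open>(m, k)\<close> by their product \<open>n = m * k\<close>. This rearrangement serves both the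
  product of two Dirichlet series and the expansion of a Lambert series into a power series.
\<close>

lemma has_sum_divisors:
  fixes F :: "nat \<Rightarrow> nat \<Rightarrow> complex"
  assumes "((\<lambda>(m, k). F m k) has_sum S) ({1..} \<times> {1..})"
  shows "((\<lambda>n. \<Sum>m | m dvd n. F m (n div m)) has_sum S) {1..}"
proof (rule has_sum_SigmaD)
  let ?T = "Sigma {1::nat..} (\<lambda>n. {m. m dvd n})"
  have "((\<lambda>(n, m). F m (n div m)) has_sum S) ?T \<longleftrightarrow>
        ((\<lambda>(m, k). F m k) has_sum S) ({1..} \<times> {1..})"
    by (rule has_sum_reindex_bij_witness[of _ "\<lambda>(m, k). (m * k, m)" "\<lambda>(n, m). (m, n div m)"])
       (auto simp: Suc_le_eq dvd_div_eq_0_iff intro!: Nat.gr0I)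
  thus "((\<lambda>(n, m). F m (n div m)) has_sum S) ?T" using assms by simp
next
  fix n :: nat assume "n \<in> {1..}"
  thus "((\<lambda>m. case (n, m) of (n, m) \<Rightarrow> F m (n div m)) has_sum
          (\<Sum>m | m dvd n. F m (n div m))) {m. m dvd n}"
    by (auto intro: has_sum_finite)
qed

lemma has_sum_from_1:
  assumes "summable (\<lambda>n. norm (f n))" and "f 0 = 0"
  shows "(f has_sum (\<Sum>n. f n :: complex)) {1..}"
proof -
  have "(f has_sum (\<Sum>n. f n)) UNIV"
    using assms(1) by (rule norm_summable_imp_has_sum)
       (rule summable_sums[OF summable_norm_cancel[OF assms(1)]])
  also have "?this \<longleftrightarrow> ?thesis"
    using assms(2) by (intro has_sum_cong_neutral) (auto simp: not_le)
  finally show ?thesis .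
qed

lemma sums_from_1:
  assumes "(f has_sum S) {1..}" and "f 0 = 0"
  shows "f sums (S :: complex)"
proof -
  have "(f has_sum S) {1..} \<longleftrightarrow> (f has_sum S) UNIV"
    using assms(2) by (intro has_sum_cong_neutral) (auto simp: not_le)
  thus ?thesis using assms(1) has_sum_imp_sums by blast
qed

lemma has_sum_product:
  fixes f g :: "_ \<Rightarrow> complex"
  assumes f: "f abs_summable_on X" "(f has_sum S) X"
    and g: "g abs_summable_on Y" "(g has_sum T) Y"
  shows "((\<lambda>(x, y). f x * g y) has_sum (S * T)) (X \<times> Y)"
proof -
  have "(\<lambda>(x, y). norm (f x) * norm (g y)) summable_on (X \<times> Y)"
    using f g
    by (intro summable_on_SigmaI[where g = "\<lambda>x. norm (f x) * (\<Sum>\<^sub>\<infinity>y\<in>Y. norm (g y))"])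
       (auto intro: has_sum_cmult_right has_sum_infsum summable_on_cmult_left)
  hence "(\<lambda>(x, y). f x * g y) abs_summable_on (X \<times> Y)"
    by (simp add: case_prod_unfold norm_mult)
  hence "(\<lambda>(x, y). f x * g y) summable_on (X \<times> Y)"
    by (rule abs_summable_summable)
  thus ?thesis
    by (intro has_sum_SigmaI[where g = "\<lambda>x. f x * T"])
       (auto intro: has_sum_cmult_right has_sum_cmult_left f g)
qed

lemma dirichlet_series_mult:
  assumes a: "summable (\<lambda>n. norm (a n * of_real (real n powr - s)))"
    and b: "summable (\<lambda>n. norm (b n * of_real (real n powr - s)))"
  shows "dirichlet_series a s * dirichlet_series b s =
         dirichlet_series (\<lambda>n. \<Sum>m | m dvd n. a m * b (n div m)) s"
proof -
  define A where "A n = a n * of_real (real n powr - s)" for n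
  define B where "B n = b n * of_real (real n powr - s)" for n
  let ?SA = "dirichlet_series a s" and ?SB = "dirichlet_series b s"
  have sumA: "(A has_sum ?SA) {1..}" and sumB: "(B has_sum ?SB) {1..}"
    unfolding dirichlet_series_def A_def B_def
    by (rule has_sum_from_1; use a b in simp)+
  have "A abs_summable_on {1..}" "B abs_summable_on {1..}"
    using a b unfolding A_def B_def
    by (auto intro!: norm_summable_imp_summable_on summable_on_subset_banach[of _ UNIV])
  hence "((\<lambda>(m, k). A m * B k) has_sum (?SA * ?SB)) ({1..} \<times> {1..})"
    using sumA sumB by (intro has_sum_product)
  hence "((\<lambda>n. \<Sum>m | m dvd n. A m * B (n div m)) has_sum (?SA * ?SB)) {1..}"
    by (rule has_sum_divisors)
  also have "?this \<longleftrightarrow> ((\<lambda>n. (\<Sum>m | m dvd n. a m * b (n div m)) * of_real (real n powr - s))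
                has_sum (?SA * ?SB)) {1..}"
  proof (rule has_sum_cong)
    fix n :: nat
    have "A m * B (n div m) = a m * b (n div m) * of_real (real n powr - s)" if "m dvd n" for m
    proof -
      from that have "real n = real m * real (n div m)" by (metis dvd_mult_div_cancel of_nat_mult)
      thus ?thesis by (simp add: A_def B_def powr_mult)
    qed
    thus "(\<Sum>m | m dvd n. A m * B (n div m)) =
            (\<Sum>m | m dvd n. a m * b (n div m)) * of_real (real n powr - s)"
      by (simp add: sum_distrib_right)
  qed
  finally have "(\<lambda>n. (\<Sum>m | m dvd n. a m * b (n div m)) * of_real (real n powr - s))
                  sums (?SA * ?SB)"
    by (rule sums_from_1) simp
  thus ?thesis
    unfolding dirichlet_series_def[of "\<lambda>n. \<Sum>m | m dvd n. a m * b (n div m)"]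
    by (rule sums_unique)
qed

lemma has_vector_derivative_series:
  fixes f :: "nat \<Rightarrow> real \<Rightarrow> 'a :: banach"
  assumes "convex S"
    and f': "\<And>n x. x \<in> S \<Longrightarrow> (f n has_vector_derivative f' n x) (at x within S)"
    and lim: "uniform_limit S (\<lambda>n x. \<Sum>i<n. f' i x) g' sequentially"
    and "x0 \<in> S" "summable (\<lambda>n. f n x0)"
  shows "\<exists>g. \<forall>x\<in>S. (\<lambda>n. f n x) sums g x \<and> (g has_vector_derivative g' x) (at x within S)"
  unfolding has_vector_derivative_def
proof (rule has_derivative_series)
  fix e :: real assume "e > 0"
  hence "\<forall>\<^sub>F n in sequentially. \<forall>x\<in>S. dist (\<Sum>i<n. f' i x) (g' x) < e"
    using lim unfolding uniform_limit_iff by blast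
  thus "\<forall>\<^sub>F n in sequentially. \<forall>x\<in>S. \<forall>h::real.
          norm ((\<Sum>i<n. h *\<^sub>R f' i x) - h *\<^sub>R g' x) \<le> e * norm h"
  proof (eventually_elim, intro ballI allI)
    fix n x and h :: real assume "\<forall>x\<in>S. dist (\<Sum>i<n. f' i x) (g' x) < e" "x \<in> S"
    hence "norm h * norm ((\<Sum>i<n. f' i x) - g' x) \<le> norm h * e"
      by (intro mult_left_mono) (auto simp: dist_norm intro: less_imp_le)
    thus "norm ((\<Sum>i<n. h *\<^sub>R f' i x) - h *\<^sub>R g' x) \<le> e * norm h"
      by (simp add: scaleR_sum_right [symmetric] scaleR_diff_right [symmetric] mult.commute)
  qed
qed (use assms in \<open>auto simp: has_vector_derivative_def intro: summable_sums\<close>)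

lemma has_vector_derivative_dirichlet_term:
  "((\<lambda>s. c * complex_of_real (real n powr - s)) has_vector_derivative
      - (c * of_real (ln (real n)) * of_real (real n powr - s))) (at s within S)"
proof -
  have "((\<lambda>s. real n powr - s) has_real_derivative - (ln (real n) * real n powr - s))
          (at s within S)"
  proof (cases "n = 0")
    case False
    have "((\<lambda>s. exp (- s * ln (real n))) has_real_derivative
             - (ln (real n) * exp (- s * ln (real n)))) (at s within S)"
      by (auto intro!: derivative_eq_intros)
    with False show ?thesis by (simp add: powr_def)
  qed auto
  hence "((\<lambda>s. c * complex_of_real (real n powr - s)) has_vector_derivative
           c * of_real (- (ln (real n) * real n powr - s))) (at s within S)"
    by (intro has_vector_derivative_mult_right has_vector_derivative_of_real)
  thus ?thesis by (simp add: mult.assoc)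
qed

text \<open>
  Termwise differentiation is justified on the half-line to the right of a point \<open>\<sigma>\<close> strictly
  between 1 and \<open>s\<close>, where the series of derivatives is dominated by its values at \<open>\<sigma>\<close>.
\<close>

lemma has_vector_derivative_dirichlet_series:
  assumes a: "\<And>n. norm (a n) \<le> 1" and s: "s > 1"
  shows "(dirichlet_series a has_vector_derivative
            - dirichlet_series (\<lambda>n. a n * of_real (ln (real n))) s) (at s)"
proof -
  define \<sigma> where "\<sigma> = (1 + s) / 2"
  have \<sigma>: "1 < \<sigma>" "\<sigma> < s" using s by (simp_all add: \<sigma>_def)
  define f' where "f' n s = - (a n * of_real (ln (real n)) * of_real (real n powr - s))" for n s
  have "\<exists>g. \<forall>x\<in>{\<sigma><..}. (\<lambda>n. a n * of_real (real n powr - x)) sums g x \<and>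
            (g has_vector_derivative (\<Sum>n. f' n x)) (at x within {\<sigma><..})"
  proof (rule has_vector_derivative_series)
    show "uniform_limit {\<sigma><..} (\<lambda>n x. \<Sum>i<n. f' i x) (\<lambda>x. \<Sum>n. f' n x) sequentially"
    proof (rule Weierstrass_m_test)
      fix n :: nat and x :: real assume x: "x \<in> {\<sigma><..}"
      have "norm (f' n x) = norm (a n) * (ln (real n) * real n powr - x)"
        by (cases "n = 0") (auto simp: f'_def norm_mult)
      also have "\<dots> \<le> 1 * (ln (real n) * real n powr - \<sigma>)"
      proof (cases "n = 0")
        case False
        thus ?thesis
          using x by (intro mult_mono[OF a mult_left_mono[OF powr_mono]]) auto
      qed auto
      finally show "norm (f' n x) \<le> ln (real n) * real n powr - \<sigma>" by simp
    qed (rule summable_ln_powr[OF \<sigma>(1)])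
  next
    show "summable (\<lambda>n. a n * of_real (real n powr - s))"
      by (rule summable_norm_cancel[OF summable_bounded_coeffs[OF a s]])
  next
    show "((\<lambda>x. a n * of_real (real n powr - x)) has_vector_derivative f' n x)
            (at x within {\<sigma><..})" for n x
      unfolding f'_def by (rule has_vector_derivative_dirichlet_term)
  qed (use \<sigma> in simp_all)
  then obtain g where g: "\<forall>x\<in>{\<sigma><..}. (\<lambda>n. a n * of_real (real n powr - x)) sums g x \<and>
            (g has_vector_derivative (\<Sum>n. f' n x)) (at x within {\<sigma><..})" by blast
  have "s \<in> {\<sigma><..}" using \<sigma>(2) by simp
  hence "(g has_vector_derivative (\<Sum>n. f' n s)) (at s)"
    using bspec[OF g] has_vector_derivative_within_open[of s "{\<sigma><..}" g] by auto
  moreover have "g x = dirichlet_series a x" if "x \<in> {\<sigma><..}" for x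
    using bspec[OF g that] by (simp add: dirichlet_series_def sums_iff)
  ultimately have "(dirichlet_series a has_vector_derivative (\<Sum>n. f' n s)) (at s)"
    using has_vector_derivative_transform_within_open[of g _ s "{\<sigma><..}"] \<sigma>(2) by auto
  moreover have "(\<Sum>n. f' n s) = - dirichlet_series (\<lambda>n. a n * of_real (ln (real n))) s"
    unfolding dirichlet_series_def f'_def by (rule suminf_minus[OF summable_ln_coeffs[OF a s]])
  ultimately show ?thesis by simp
qed

section \<open>Summation by parts and the behaviour of L near 1\<close>

text \<open>
  Summation by parts: the differences \<open>g n - g (Suc n)\<close> are nonnegative and telescope, so the size
  of the weighted sum is governed by the partial sums of \<open>c\<close> and the first weight.
\<close>

lemma norm_sum_mult_antimono_le:
  fixes c :: "nat \<Rightarrow> 'a :: real_normed_vector" and g :: "nat \<Rightarrow> real"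
  assumes B: "\<And>n. norm (\<Sum>k<n. c k) \<le> B"
    and g: "\<And>n. n \<ge> M \<Longrightarrow> 0 \<le> g n" "\<And>n. n \<ge> M \<Longrightarrow> g (Suc n) \<le> g n"
  shows "norm (\<Sum>n=M..<N. g n *\<^sub>R c n) \<le> 2 * B * g M"
proof (cases "M \<le> N")
  case False
  have "0 \<le> B" using B[of 0] by simp
  with False show ?thesis using g(1)[of M] by simp
next
  case True
  define S where "S n = (\<Sum>k<n. c k)" for n
  have abel: "(\<Sum>n=M..<N. g n *\<^sub>R c n) =
          g N *\<^sub>R S N - g M *\<^sub>R S M + (\<Sum>n=M..<N. (g n - g (Suc n)) *\<^sub>R S (Suc n))"
    using True
  proof (induction N rule: dec_induct)
    case (step N)
    thus ?case by (simp add: S_def algebra_simps)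
  qed simp
  have "norm (\<Sum>n=M..<N. (g n - g (Suc n)) *\<^sub>R S (Suc n)) \<le> (\<Sum>n=M..<N. (g n - g (Suc n)) * B)"
    by (rule sum_norm_le) (use g(2) B in \<open>auto simp: S_def simp del: sum.lessThan_Suc intro!: mult_mono\<close>)
  also have "\<dots> = (g M - g N) * B"
    using sum_Suc_diff'[of M N "\<lambda>n. - g n"] True by (simp add: sum_distrib_right [symmetric])
  finally have 1: "norm (\<Sum>n=M..<N. (g n - g (Suc n)) *\<^sub>R S (Suc n)) \<le> (g M - g N) * B" .
  have "norm (g N *\<^sub>R S N - g M *\<^sub>R S M) \<le> g N * B + g M * B"
    using g(1) True B
    by (intro norm_triangle_le_diff add_mono) (auto simp: S_def intro!: mult_mono)
  with 1 show ?thesis unfolding abel by (intro norm_triangle_le) (simp add: algebra_simps)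
qed

lemma summable_mult_antimono:
  fixes c :: "nat \<Rightarrow> 'a :: banach" and g :: "nat \<Rightarrow> real"
  assumes B: "\<And>n. norm (\<Sum>k<n. c k) \<le> B"
    and g: "\<And>n. n \<ge> M \<Longrightarrow> 0 \<le> g n" "\<And>n. n \<ge> M \<Longrightarrow> g (Suc n) \<le> g n" "g \<longlonglongrightarrow> 0"
  shows "summable (\<lambda>n. g n *\<^sub>R c n)"
  unfolding summable_Cauchy
proof (intro allI impI)
  fix e :: real assume "e > 0"
  have "(\<lambda>n. 2 * B * g n) \<longlonglongrightarrow> 2 * B * 0" by (intro tendsto_intros g)
  hence "eventually (\<lambda>n. 2 * B * g n < e) sequentially"
    using \<open>e > 0\<close> by (intro order_tendstoD(2)) auto
  then obtain N where N: "\<And>n. n \<ge> N \<Longrightarrow> 2 * B * g n < e"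
    by (auto simp: eventually_at_top_linorder)
  have "norm (\<Sum>n=m..<n. g n *\<^sub>R c n) < e" if "m \<ge> max M N" for m n
    using norm_sum_mult_antimono_le[of c B m g n] B g that N[of m] by force
  thus "\<exists>N. \<forall>m\<ge>N. \<forall>n. norm (\<Sum>n=m..<n. g n *\<^sub>R c n) < e" by blast
qed

text \<open>
  Full periods cancel, so only the at most \<open>d\<close> terms of an incomplete period remain.
\<close>

lemma norm_sum_dirichlet_char_le:
  assumes "dirichlet_char d \<chi>" and "d > 0" and "\<chi> \<noteq> principal_char d"
  shows "norm (\<Sum>k<n. \<chi> k) \<le> d"
proof (induction n rule: less_induct)
  case (less n)
  show ?case
  proof (cases "n < d")
    case True
    have "norm (\<Sum>k<n. \<chi> k) \<le> (\<Sum>k<n. 1 :: real)"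
      by (intro sum_norm_le) (simp add: norm_dirichlet_char[OF assms(1,2)])
    with True show ?thesis by simp
  next
    case False
    have "(\<Sum>k<n. \<chi> k) = (\<Sum>k<d. \<chi> k) + (\<Sum>k=0+d..<(n-d)+d. \<chi> k)"
      using False by (subst sum.union_disjoint [symmetric]) (auto intro!: sum.cong)
    also have "(\<Sum>k=0+d..<(n-d)+d. \<chi> k) = (\<Sum>k<n-d. \<chi> (k + d))"
      by (simp only: sum.shift_bounds_nat_ivl atLeast0LessThan)
    also have "\<dots> = (\<Sum>k<n-d. \<chi> k)"
      using dirichlet_char_mod[OF assms(1)] by (intro sum.cong refl) (metis mod_add_self2)
    finally show ?thesis
      using less.IH[of "n - d"] assms False by (simp add: sum_dirichlet_char_period)
  qed
qed

lemma ln_mult_powr_le_1: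
  assumes "s \<ge> 1"
  shows "ln (real n) * real n powr - s \<le> 1"
proof (cases "n = 0")
  case False
  have "ln (real n) * real n powr - s \<le> real n * real n powr - 1"
    using assms False ln_le_minus_one[of "real n"] by (intro mult_mono powr_mono) auto
  thus ?thesis using False by (simp add: powr_minus)
qed auto

text \<open>
  The function \<open>ln x / x\<close> decreases only from \<open>x = exp 1\<close> on, hence the bound 3.
\<close>

lemma ln_mult_powr_antimono:
  assumes "s \<ge> 1" and "n \<ge> 3"
  shows "ln (real (Suc n)) * real (Suc n) powr - s \<le> ln (real n) * real n powr - s"
proof -
  have eq: "ln (real m) * real m powr - s = ln (real m) / real m * real m powr (1 - s)"
    if "m > 0" for m :: nat
    using that by (simp add: powr_diff powr_minus divide_simps)
  have "exp 1 \<le> real n" using exp_le assms(2) by simp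
  hence "ln (real (Suc n)) / real (Suc n) \<le> ln (real n) / real n"
    by (intro ln_x_over_x_mono) auto
  moreover have "real (Suc n) powr (1 - s) \<le> real n powr (1 - s)"
    using assms by (intro powr_mono2') auto
  ultimately have "ln (real (Suc n)) / real (Suc n) * real (Suc n) powr (1 - s)
      \<le> ln (real n) / real n * real n powr (1 - s)"
    using assms by (intro mult_mono) auto
  thus ?thesis using eq[of n] eq[of "Suc n"] assms by linarith
qed

locale nonprincipal_char =
  fixes d :: nat and \<chi> :: "nat \<Rightarrow> complex"
  assumes char: "dirichlet_char d \<chi>" and d: "d > 0" and nonprincipal: "\<chi> \<noteq> principal_char d"
begin

text \<open>
  A bound for the partial sums of the series of \<open>- L'(s, \<chi>)\<close>, uniform down to \<open>s = 1\<close>. The terms before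
  index 3 are bounded by 1 each, the others are weighted by a decreasing sequence.
\<close>

lemma norm_sum_ln_le:
  assumes "s \<ge> 1"
  shows "norm (\<Sum>n<N. \<chi> n * of_real (ln (real n)) * of_real (real n powr - s)) \<le> 3 + 2 * real d"
proof -
  define g where "g n = ln (real n) * real n powr - s" for n :: nat
  have g: "0 \<le> g n" "g n \<le> 1" for n
    using ln_mult_powr_le_1[OF assms] by (cases "n = 0"; simp add: g_def)+
  have "(\<Sum>n<N. g n *\<^sub>R \<chi> n) = (\<Sum>n<min 3 N. g n *\<^sub>R \<chi> n) + (\<Sum>n=3..<N. g n *\<^sub>R \<chi> n)"
    by (subst sum.union_disjoint [symmetric]) (auto intro!: sum.cong)
  also have "norm \<dots> \<le> 3 + 2 * real d"
  proof (rule norm_triangle_mono)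
    have "norm (\<Sum>n<min 3 N. g n *\<^sub>R \<chi> n) \<le> (\<Sum>n<min 3 N. 1)"
      by (intro sum_norm_le)
         (use g norm_dirichlet_char[OF char d] in \<open>auto simp: abs_of_nonneg\<close>)
    thus "norm (\<Sum>n<min 3 N. g n *\<^sub>R \<chi> n) \<le> 3" by simp
  next
    have "norm (\<Sum>n=3..<N. g n *\<^sub>R \<chi> n) \<le> 2 * real d * g 3"
      using ln_mult_powr_antimono[OF assms] norm_sum_dirichlet_char_le[OF char d nonprincipal] g
      by (intro norm_sum_mult_antimono_le) (auto simp: g_def)
    also have "\<dots> \<le> 2 * real d * 1" using g by (intro mult_left_mono) auto
    finally show "norm (\<Sum>n=3..<N. g n *\<^sub>R \<chi> n) \<le> 2 * real d" by simp
  qed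
  finally show ?thesis by (simp add: g_def scaleR_conv_of_real mult_ac)
qed

lemma summable_L:
  assumes "s \<ge> 1"
  shows "summable (\<lambda>n. \<chi> n * of_real (real n powr - s))"
proof -
  have "summable (\<lambda>n. real n powr - s *\<^sub>R \<chi> n)"
  proof (rule summable_mult_antimono[where M = 1])
    have "(\<lambda>n. real n powr - s) \<longlonglongrightarrow> 0"
      using assms by (intro tendsto_neg_powr filterlim_real_sequentially) auto
    thus "(\<lambda>n. real n powr - s) \<longlonglongrightarrow> 0" .
  qed (use norm_sum_dirichlet_char_le[OF char d nonprincipal] assms
       in \<open>auto intro!: powr_mono2'\<close>)
  thus ?thesis by (simp add: scaleR_conv_of_real mult_ac)
qed

text \<open>
  The mean value theorem is applied to the partial sums, whose derivatives are bounded uniformly by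
  \<open>norm_sum_ln_le\<close>; in this way no differentiability of the limit at \<open>s = 1\<close> has to be discussed.
\<close>

lemma norm_L_diff_le:
  assumes "s \<ge> 1"
  shows "norm (dirichlet_series \<chi> s - dirichlet_series \<chi> 1) \<le> (3 + 2 * real d) * (s - 1)"
proof (rule LIMSEQ_le_const2)
  let ?P = "\<lambda>N s. \<Sum>n<N. \<chi> n * of_real (real n powr - s)"
  show "(\<lambda>N. norm (?P N s - ?P N 1)) \<longlonglongrightarrow> norm (dirichlet_series \<chi> s - dirichlet_series \<chi> 1)"
    unfolding dirichlet_series_def using assms
    by (intro tendsto_intros summable_LIMSEQ summable_L) auto
  have "norm (?P N s - ?P N 1) \<le> (3 + 2 * real d) * (s - 1)" for N
  proof -
    let ?D = "\<lambda>s. \<Sum>n<N. \<chi> n * of_real (ln (real n)) * of_real (real n powr - s)"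
    have "norm (?P N s - ?P N 1) \<le> (3 + 2 * real d) * norm (s - 1)"
    proof (rule differentiable_bound)
      fix x :: real assume x: "x \<in> {1..}"
      have "(?P N has_vector_derivative (\<Sum>n<N. - (\<chi> n * of_real (ln (real n)) * of_real (real n powr - x))))
              (at x within {1..})"
        by (intro has_vector_derivative_sum has_vector_derivative_dirichlet_term)
      thus "(?P N has_derivative (\<lambda>h. h *\<^sub>R - ?D x)) (at x within {1..})"
        by (simp add: has_vector_derivative_def sum_negf)
      show "onorm (\<lambda>h. h *\<^sub>R - ?D x) \<le> 3 + 2 * real d"
        using mult_left_mono[OF norm_sum_ln_le[of x N]] x
        by (intro onorm_le) (auto simp: mult.commute)
    qed (use assms in auto)
    with assms show ?thesis by simp
  qed
  thus "\<exists>M. \<forall>N\<ge>M. norm (?P N s - ?P N 1) \<le> (3 + 2 * real d) * (s - 1)" by blast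
qed

lemma tendsto_L: "(dirichlet_series \<chi> \<longlongrightarrow> dirichlet_series \<chi> 1) (at_right 1)"
proof -
  have "((\<lambda>s. (3 + 2 * real d) * (s - 1)) \<longlongrightarrow> (3 + 2 * real d) * (1 - 1)) (at_right 1)"
    by (intro tendsto_intros)
  hence lim: "((\<lambda>s. (3 + 2 * real d) * (s - 1)) \<longlongrightarrow> 0) (at_right 1)" by simp
  have "eventually (\<lambda>s. norm (dirichlet_series \<chi> s - dirichlet_series \<chi> 1)
           \<le> (3 + 2 * real d) * (s - 1)) (at_right 1)"
    using norm_L_diff_le by (auto simp: eventually_at_filter)
  hence "((\<lambda>s. dirichlet_series \<chi> s - dirichlet_series \<chi> 1) \<longlongrightarrow> 0) (at_right 1)"
    using lim by (rule Lim_null_comparison)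
  thus ?thesis by (rule LIM_zero_cancel)
qed

end

text \<open>
  Comparison with the integral of \<open>x powr - s\<close>, in the form of the mean value theorem for its
  antiderivative on each unit interval.
\<close>

lemma zeta_bound:
  assumes "s > (1::real)"
  shows "(\<Sum>n. real n powr - s) \<le> 1 + 1 / (s - 1)"
proof (rule suminf_le_const)
  show "summable (\<lambda>n. real n powr - s)" using assms by (simp add: summable_real_powr_iff)
next
  fix N
  have step: "real (Suc n) powr - s \<le> (real n powr (1 - s) - real (Suc n) powr (1 - s)) / (s - 1)"
    if "n > 0" for n
  proof -
    have "\<exists>z>real n. z < real (Suc n) \<and> real (Suc n) powr (1 - s) - real n powr (1 - s) =
            (real (Suc n) - real n) * ((1 - s) * z powr - s)"
    proof (rule MVT2)
      fix x assume "real n \<le> x"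
      thus "((\<lambda>x. x powr (1 - s)) has_real_derivative (1 - s) * x powr - s) (at x)"
        using that by (auto intro!: derivative_eq_intros)
    qed auto
    then obtain z where z: "real n < z" "z < real (Suc n)"
      "real n powr (1 - s) - real (Suc n) powr (1 - s) = (s - 1) * z powr - s"
      by (auto simp: algebra_simps)
    have "real (Suc n) powr - s \<le> z powr - s" using z assms by (intro powr_mono2') auto
    also have "\<dots> = (real n powr (1 - s) - real (Suc n) powr (1 - s)) / (s - 1)"
      using z(3) assms by simp
    finally show ?thesis .
  qed
  have "(\<Sum>n<Suc (Suc N). real n powr - s) \<le> 1 + (1 - real (Suc N) powr (1 - s)) / (s - 1)" for N
  proof (induction N)
    case (Suc N)
    thus ?case using step[of "Suc N"] by (simp add: diff_divide_distrib)
  qed simp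
  from this[of N] have "(\<Sum>n<Suc (Suc N). real n powr - s) \<le> 1 + 1 / (s - 1)"
    using assms by (simp add: diff_divide_distrib) (smt (verit) divide_nonneg_nonneg powr_ge_zero)
  moreover have "(\<Sum>n<N. real n powr - s) \<le> (\<Sum>n<Suc (Suc N). real n powr - s)"
    by (intro sum_mono2) auto
  ultimately show "(\<Sum>n<N. real n powr - s) \<le> 1 + 1 / (s - 1)" by linarith
qed

lemma norm_dirichlet_series_le_zeta:
  assumes "\<And>n. norm (a n) \<le> 1" and "s > 1"
  shows "norm (dirichlet_series a s) \<le> s / (s - 1)"
proof -
  have "norm (dirichlet_series a s) \<le> (\<Sum>n. 1 * real n powr - s)"
    using assms by (intro norm_dirichlet_series_le) (auto simp: summable_real_powr_iff)
  also have "\<dots> \<le> s / (s - 1)" using zeta_bound[OF assms(2)] assms(2) by (simp add: field_simps)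
  finally show ?thesis .
qed

text \<open>
  At \<open>s = 3\<close> the first term 1 exceeds the sum of the absolute values of all others, which is at most
  one half. This supplies one point where a monotonic quantity below is known to be positive.
\<close>

lemma dirichlet_series_3_nonzero:
  assumes a: "\<And>n. norm (a n) \<le> 1" and "a 1 = 1"
  shows "dirichlet_series a 3 \<noteq> 0"
proof -
  let ?e = "\<lambda>n::nat. if n = 1 then 1 else 0"
  have sa: "summable (\<lambda>n. a n * of_real (real n powr - 3))"
    by (rule summable_norm_cancel[OF summable_bounded_coeffs[OF a]]) simp
  have sz: "summable (\<lambda>n. real n powr - 3)" by (simp add: summable_real_powr_iff)
  have se: "?e sums (1::complex)" "?e sums (1::real)" using sums_single[of 1 "\<lambda>_. 1"] by simp_all
  have "dirichlet_series a 3 - 1 = (\<Sum>n. a n * of_real (real n powr - 3) - ?e n)"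
    using suminf_diff[OF sa sums_summable[OF se(1)]] sums_unique[OF se(1)]
    by (simp add: dirichlet_series_def)
  also have "norm \<dots> \<le> (\<Sum>n. real n powr - 3 - ?e n)"
  proof (rule norm_suminf_le)
    show "summable (\<lambda>n. real n powr - 3 - ?e n)"
      by (rule summable_diff[OF sz sums_summable[OF se(2)]])
    show "norm (a n * of_real (real n powr - 3) - ?e n) \<le> real n powr - 3 - ?e n" for n
      using a[of n] assms(2) by (auto simp: norm_mult intro: mult_left_le_one_le)
  qed
  also have "\<dots> = (\<Sum>n. real n powr - 3) - 1"
    using suminf_diff[OF sz sums_summable[OF se(2)]] sums_unique[OF se(2)] by simp
  also have "\<dots> \<le> 1 / 2" using zeta_bound[of 3] by simp
  finally show ?thesis by auto
qed

section \<open>Nonvanishing for nonreal characters\<close>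

text \<open>
  For a character this is the negative logarithmic derivative \<open>- L'(s, \<chi>) / L(s, \<chi>)\<close>. As a series it
  makes sense without knowing that \<open>L\<close> has no zeros.
\<close>

definition mangoldt_series :: "(nat \<Rightarrow> complex) \<Rightarrow> real \<Rightarrow> complex" where
  "mangoldt_series a s = dirichlet_series (\<lambda>n. a n * mangoldt n) s"

lemma mangoldt_le_ln: "mangoldt n \<le> ln (real n)"
  using mangoldt_le[of n] by (cases "n = 0") auto

lemma summable_mangoldt_series:
  fixes a :: "nat \<Rightarrow> complex"
  assumes "\<And>n. norm (a n) \<le> C" and "s > 1"
  shows "summable (\<lambda>n. norm (a n * mangoldt n * of_real (real n powr - s)))"
proof (rule summable_log_bounded_coeffs[OF _ assms(2)])
  fix n
  have "0 \<le> C" using norm_ge_zero[of "a 0"] assms(1)[of 0] by linarith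
  moreover have "norm (a n) * mangoldt n \<le> C * ln (real n)"
    using assms(1) mangoldt_le_ln \<open>0 \<le> C\<close> by (intro mult_mono) (auto simp: mangoldt_nonneg)
  ultimately show "norm (a n * mangoldt n) \<le> C * (1 + ln (real n))"
    by (simp add: norm_mult algebra_simps)
qed

lemma mangoldt_series_add:
  assumes "\<And>n. norm (a n) \<le> C" "\<And>n. norm (b n) \<le> C'" and "s > 1"
  shows "mangoldt_series (\<lambda>n. a n + b n) s = mangoldt_series a s + mangoldt_series b s"
  using suminf_add[OF summable_norm_cancel[OF summable_mangoldt_series[OF assms(1,3)]]
                      summable_norm_cancel[OF summable_mangoldt_series[OF assms(2,3)]]]
  by (simp add: mangoldt_series_def dirichlet_series_def algebra_simps)

lemma mangoldt_series_cmult: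
  assumes "\<And>n. norm (a n) \<le> C" and "s > 1"
  shows "mangoldt_series (\<lambda>n. c * a n) s = c * mangoldt_series a s"
  using suminf_mult[OF summable_norm_cancel[OF summable_mangoldt_series[OF assms]], of c]
  by (simp add: mangoldt_series_def dirichlet_series_def algebra_simps)

lemma Re_mangoldt_series_nonneg:
  assumes "\<And>n. norm (a n) \<le> C" and "s > 1" and "\<And>n. Re (a n) \<ge> 0"
  shows "Re (mangoldt_series a s) \<ge> 0"
proof -
  note sm = summable_norm_cancel[OF summable_mangoldt_series[OF assms(1,2)]]
  have "Re (mangoldt_series a s) = (\<Sum>n. Re (a n * mangoldt n * of_real (real n powr - s)))"
    unfolding mangoldt_series_def dirichlet_series_def using Re_suminf[OF sm] by simp
  also have "\<dots> \<ge> 0"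
    by (intro suminf_nonneg summable_Re sm) (auto simp: assms(3) mangoldt_nonneg)
  finally show ?thesis .
qed

text \<open>
  The divisor sum of the von Mangoldt function is the logarithm, and a completely multiplicative
  factor passes through the convolution.
\<close>

lemma mangoldt_series_mult_L:
  assumes \<chi>: "dirichlet_char d \<chi>" and d: "d > 0" and s: "s > 1"
  shows "mangoldt_series \<chi> s * dirichlet_series \<chi> s =
         dirichlet_series (\<lambda>n. \<chi> n * of_real (ln (real n))) s"
proof -
  have "(\<Sum>m | m dvd n. \<chi> m * mangoldt m * \<chi> (n div m)) = \<chi> n * of_real (ln (real n))" for n
  proof (cases "n = 0")
    case False
    have "\<chi> m * mangoldt m * \<chi> (n div m) = \<chi> n * mangoldt m" if "m dvd n" for m
      using that dirichlet_char_mult[OF \<chi>, of m "n div m"] by simp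
    hence "(\<Sum>m | m dvd n. \<chi> m * mangoldt m * \<chi> (n div m)) = (\<Sum>m | m dvd n. \<chi> n * mangoldt m)"
      by (intro sum.cong refl) auto
    also have "\<dots> = \<chi> n * (\<Sum>m | m dvd n. mangoldt m)" by (rule sum_distrib_left [symmetric])
    finally show ?thesis using mangoldt_sum[OF False, where ?'a = complex] by simp
  qed auto
  thus ?thesis
    unfolding mangoldt_series_def
    using dirichlet_series_mult[OF summable_mangoldt_series[OF norm_dirichlet_char_le_1[OF \<chi> d] s]
                                   summable_bounded_coeffs[OF norm_dirichlet_char_le_1[OF \<chi> d] s]]
    by simp
qed

text \<open>
  Since \<open>L' = - A * L\<close> for the von Mangoldt series \<open>A\<close>, the squared modulus satisfies a real linear
  differential equation. This replaces complex logarithms of \<open>L\<close>.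
\<close>

lemma DERIV_norm_L_squared:
  assumes \<chi>: "dirichlet_char d \<chi>" and d: "d > 0" and s: "s > 1"
  shows "((\<lambda>s. (norm (dirichlet_series \<chi> s))\<^sup>2) has_real_derivative
           - 2 * Re (mangoldt_series \<chi> s) * (norm (dirichlet_series \<chi> s))\<^sup>2) (at s)"
proof -
  let ?L = "dirichlet_series \<chi>" and ?A = "mangoldt_series \<chi> s"
  have "(?L has_vector_derivative - (?A * ?L s)) (at s)"
    using has_vector_derivative_dirichlet_series[OF norm_dirichlet_char_le_1[OF \<chi> d] s]
    by (simp add: mangoldt_series_mult_L[OF assms])
  hence L: "(?L has_derivative (\<lambda>h. h *\<^sub>R - (?A * ?L s))) (at s)"
    by (simp add: has_vector_derivative_def)
  have "((\<lambda>s. ?L s \<bullet> ?L s) has_derivative (\<lambda>h. ?L s \<bullet> (h *\<^sub>R - (?A * ?L s)) + (h *\<^sub>R - (?A * ?L s)) \<bullet> ?L s)) (at s)"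
    by (rule has_derivative_inner[OF L L])
  also have "(\<lambda>h. ?L s \<bullet> (h *\<^sub>R - (?A * ?L s)) + (h *\<^sub>R - (?A * ?L s)) \<bullet> ?L s) =
        (*) (- 2 * Re ?A * (norm (?L s))\<^sup>2)"
    unfolding cmod_power2
    by (simp add: fun_eq_iff inner_complex_def power2_eq_square algebra_simps)
  finally show ?thesis unfolding has_field_derivative_def power2_norm_eq_inner .
qed

lemma Re_3_4_1_nonneg:
  assumes "norm z = 1"
  shows "Re (3 + 4 * z + z ^ 2) \<ge> 0"
proof -
  have "(Re z)\<^sup>2 + (Im z)\<^sup>2 = 1" using assms by (simp add: cmod_def)
  hence "Re (3 + 4 * z + z ^ 2) = 2 * (1 + Re z)\<^sup>2"
    by (simp add: power2_eq_square algebra_simps)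
  thus ?thesis by simp
qed

text \<open>
  Mertens' inequality \<open>3 + 4 cos \<phi> + cos 2\<phi> \<ge> 0\<close> shows that
  \<open>|L(s, \<chi>\<^sub>0)|\<^sup>3 |L(s, \<chi>)|\<^sup>4 |L(s, \<chi>\<^sup>2)|\<close> does not decrease as \<open>s\<close> falls to 1, so it stays bounded away
  from 0. If \<open>L(1, \<chi>) = 0\<close>, then the second factor is of size \<open>(s - 1)\<^sup>4\<close>, the first
  one is at most of size \<open>(s - 1)\<^sup>-\<^sup>3\<close>, and the third one is bounded when \<open>\<chi>\<^sup>2\<close> is not principal:
  the product would tend to 0. The function \<open>F\<close> in the proof is the square of this product.
\<close>

theorem L_1_nonzero_nonreal:
  assumes \<chi>: "nonprincipal_char d \<chi>" and \<chi>2: "nonprincipal_char d (\<lambda>n. \<chi> n ^ 2)"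
  shows "dirichlet_series \<chi> 1 \<noteq> 0"
proof
  assume L1: "dirichlet_series \<chi> 1 = 0"
  interpret \<chi>: nonprincipal_char d \<chi> by fact
  interpret \<chi>2: nonprincipal_char d "\<lambda>n. \<chi> n ^ 2" by fact
  let ?\<chi>0 = "principal_char d" and ?\<chi>2 = "\<lambda>n. \<chi> n ^ 2"
  define u where "u \<psi> s = (norm (dirichlet_series \<psi> s))\<^sup>2" for \<psi> s
  define F where "F s = u ?\<chi>0 s ^ 3 * u \<chi> s ^ 4 * u ?\<chi>2 s" for s
  note d = \<chi>.d
  note chars = dirichlet_char_principal[of d] \<chi>.char \<chi>2.char
  note le1 = chars[THEN norm_dirichlet_char_le_1[OF _ d]]

  have combined: "3 * Re (mangoldt_series ?\<chi>0 s) + 4 * Re (mangoldt_series \<chi> s)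
        + Re (mangoldt_series ?\<chi>2 s) \<ge> 0" if s: "s > 1" for s
  proof -
    have le3: "norm (3 * ?\<chi>0 n) \<le> 3" "norm (4 * \<chi> n) \<le> 4" "norm (3 * ?\<chi>0 n + 4 * \<chi> n) \<le> 7"
      "norm (3 * ?\<chi>0 n + 4 * \<chi> n + ?\<chi>2 n) \<le> 8" for n
      using le1[of n] norm_triangle_ineq[of "3 * ?\<chi>0 n" "4 * \<chi> n"]
        norm_triangle_ineq[of "3 * ?\<chi>0 n + 4 * \<chi> n" "?\<chi>2 n"]
      by (auto simp: norm_mult)
    have "0 \<le> Re (mangoldt_series (\<lambda>n. 3 * ?\<chi>0 n + 4 * \<chi> n + ?\<chi>2 n) s)"
    proof (rule Re_mangoldt_series_nonneg[OF le3(4) s])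
      fix n
      show "0 \<le> Re (3 * ?\<chi>0 n + 4 * \<chi> n + ?\<chi>2 n)"
      proof (cases "coprime n d")
        case True
        hence "norm (\<chi> n) = 1" using norm_dirichlet_char[OF \<chi>.char d] by simp
        from Re_3_4_1_nonneg[OF this] True show ?thesis by (simp add: principal_char_def)
      next
        case False
        hence "\<chi> n = 0" using dirichlet_char_eq_0_iff[OF \<chi>.char] by simp
        with False show ?thesis by (simp add: principal_char_def)
      qed
    qed
    also have "mangoldt_series (\<lambda>n. 3 * ?\<chi>0 n + 4 * \<chi> n + ?\<chi>2 n) s =
        3 * mangoldt_series ?\<chi>0 s + 4 * mangoldt_series \<chi> s + mangoldt_series ?\<chi>2 s"
      using mangoldt_series_add[OF le3(3) le1(3) s] mangoldt_series_add[OF le3(1,2) s]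
        mangoldt_series_cmult[OF le1(1) s] mangoldt_series_cmult[OF le1(2) s] by simp
    finally show ?thesis by simp
  qed

  have F_mono: "F 3 \<le> F s" if s: "1 < s" "s \<le> 3" for s
  proof (rule DERIV_nonpos_imp_nonincreasing[OF s(2)])
    fix x assume "s \<le> x"
    hence x: "x > 1" using s by simp
    let ?A0 = "Re (mangoldt_series ?\<chi>0 x)" and ?A1 = "Re (mangoldt_series \<chi> x)"
      and ?A2 = "Re (mangoldt_series ?\<chi>2 x)"
    have u': "(u \<psi> has_real_derivative - 2 * Re (mangoldt_series \<psi> x) * u \<psi> x) (at x)"
      if "dirichlet_char d \<psi>" for \<psi>
      using DERIV_norm_L_squared[OF that d x] unfolding u_def .
    have "(F has_real_derivative - 2 * (3 * ?A0 + 4 * ?A1 + ?A2) * F x) (at x)"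
      unfolding F_def
      by (rule derivative_eq_intros u'[OF chars(1)] u'[OF chars(2)] u'[OF chars(3)] refl)+
         (simp add: eval_nat_numeral algebra_simps)
    moreover have "F x \<ge> 0" by (simp add: F_def u_def)
    hence "- 2 * (3 * ?A0 + 4 * ?A1 + ?A2) * F x \<le> 0"
      using combined[OF x] by (intro mult_nonpos_nonneg) auto
    ultimately show "\<exists>y. (F has_real_derivative y) (at x) \<and> y \<le> 0" by blast
  qed

  have "u \<psi> 3 > 0" if "dirichlet_char d \<psi>" for \<psi>
    using dirichlet_series_3_nonzero[of \<psi>, OF norm_dirichlet_char_le_1[OF that d] dirichlet_char_1[OF that]]
    by (simp add: u_def)
  hence "u ?\<chi>0 3 > 0" "u \<chi> 3 > 0" "u ?\<chi>2 3 > 0" using chars by blast+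
  hence "F 3 > 0" by (simp add: F_def)

  \<comment> \<open>\<open>C\<close> is the Lipschitz constant of both L-functions at 1, and \<open>K\<close> bounds the third factor for \<open>s \<le> 3\<close>\<close>
  define C where "C = 3 + 2 * real d"
  define K where "K = norm (dirichlet_series ?\<chi>2 1) + 2 * C"
  have upper: "F s \<le> (3 ^ 6 * C ^ 8 * K ^ 2) * (s - 1)\<^sup>2" if s: "1 < s" "s \<le> 3" for s
  proof -
    have C: "C \<ge> 0" by (simp add: C_def)
    have "norm (dirichlet_series ?\<chi>0 s) \<le> s / (s - 1)"
      by (rule norm_dirichlet_series_le_zeta[OF le1(1) s(1)])
    also have "\<dots> \<le> 3 / (s - 1)" using s by (intro divide_right_mono) auto
    finally have b0: "norm (dirichlet_series ?\<chi>0 s) \<le> 3 / (s - 1)" .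
    have b1: "norm (dirichlet_series \<chi> s) \<le> C * (s - 1)"
      using \<chi>.norm_L_diff_le[of s] s by (simp add: L1 C_def)
    have "norm (dirichlet_series ?\<chi>2 s) \<le>
            norm (dirichlet_series ?\<chi>2 1) + norm (dirichlet_series ?\<chi>2 s - dirichlet_series ?\<chi>2 1)"
      by (rule norm_triangle_sub)
    also have "norm (dirichlet_series ?\<chi>2 s - dirichlet_series ?\<chi>2 1) \<le> C * (s - 1)"
      using \<chi>2.norm_L_diff_le[of s] s by (simp add: C_def)
    also have "\<dots> \<le> C * 2" using s C by (intro mult_left_mono) auto
    finally have b2: "norm (dirichlet_series ?\<chi>2 s) \<le> K" by (simp add: K_def)
    have "F s \<le> ((3 / (s - 1))\<^sup>2) ^ 3 * ((C * (s - 1))\<^sup>2) ^ 4 * K\<^sup>2"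
      unfolding F_def u_def using b0 b1 b2 s C by (intro mult_mono power_mono) auto
    also have "\<dots> = (3 ^ 6 * C ^ 8 * K ^ 2) * (s - 1)\<^sup>2"
    proof -
      have "((3 / x)\<^sup>2) ^ 3 * ((C * x)\<^sup>2) ^ 4 * K\<^sup>2 = (3 ^ 6 * C ^ 8 * K ^ 2) * x\<^sup>2" if "x \<noteq> 0" for x
        using that by (simp add: eval_nat_numeral divide_simps)
      thus ?thesis using s by simp
    qed
    finally show ?thesis .
  qed
  have "((\<lambda>s. (3 ^ 6 * C ^ 8 * K ^ 2) * (s - 1)\<^sup>2) \<longlongrightarrow> (3 ^ 6 * C ^ 8 * K ^ 2) * (1 - 1)\<^sup>2) (at_right 1)"
    by (intro tendsto_intros)
  moreover have "eventually (\<lambda>s. F 3 \<le> (3 ^ 6 * C ^ 8 * K ^ 2) * (s - 1)\<^sup>2) (at_right 1)"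
    unfolding eventually_at_right_field
  proof (intro exI[of _ 3] conjI allI impI)
    fix s :: real assume "1 < s" "s < 3"
    thus "F 3 \<le> (3 ^ 6 * C ^ 8 * K ^ 2) * (s - 1)\<^sup>2"
      using F_mono[of s] upper[of s] by linarith
  qed simp
  ultimately have "F 3 \<le> (3 ^ 6 * C ^ 8 * K ^ 2) * (1 - 1)\<^sup>2"
    by (intro tendsto_lowerbound[of _ _ "at_right 1"]) auto
  with \<open>F 3 > 0\<close> show False by simp
qed

section \<open>Nonvanishing for real characters\<close>

text \<open>
  Every divisor of \<open>p ^ k * m\<close> is uniquely \<open>p ^ i * e\<close> with \<open>i \<le> k\<close> and \<open>e\<close> dividing \<open>m\<close>.
\<close>

lemma sum_divisors_prime_power_times:
  fixes f :: "nat \<Rightarrow> real"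
  assumes p: "prime p" and m: "\<not> p dvd m" and f: "\<And>x y. f (x * y) = f x * f y" "f 1 = 1"
  shows "(\<Sum>x | x dvd p ^ k * m. f x) = (\<Sum>i\<le>k. f p ^ i) * (\<Sum>e | e dvd m. f e)"
proof -
  have pow: "f (p ^ i) = f p ^ i" for i by (induction i) (use f in auto)
  have m0: "m \<noteq> 0" using m by (cases "m = 0") auto
  have mult: "multiplicity p (p ^ i * e) = i" if "e dvd m" for i e
  proof -
    have "\<not> p dvd e" "e \<noteq> 0" using that m m0 dvd_trans by auto
    thus ?thesis
      using p by (simp add: prime_elem_multiplicity_mult_distrib not_dvd_imp_multiplicity_0)
  qed
  have "bij_betw (\<lambda>(i, e). p ^ i * e) ({..k} \<times> {e. e dvd m}) {x. x dvd p ^ k * m}"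
    unfolding bij_betw_def
  proof (intro conjI subset_antisym subsetI)
    show "inj_on (\<lambda>(i, e). p ^ i * e) ({..k} \<times> {e. e dvd m})"
    proof (rule inj_onI, clarify)
      fix i e j e' assume "e dvd m" "e' dvd m" and eq: "p ^ i * e = p ^ j * e'"
      hence "i = j" using mult by metis
      with eq p show "i = j \<and> e = e'" by (auto simp: prime_gt_0_nat)
    qed
  next
    fix x assume "x \<in> (\<lambda>(i, e). p ^ i * e) ` ({..k} \<times> {e. e dvd m})"
    thus "x \<in> {x. x dvd p ^ k * m}" by (auto intro!: mult_dvd_mono le_imp_power_dvd)
  next
    fix x assume "x \<in> {x. x dvd p ^ k * m}"
    hence "x dvd p ^ k * m" by simp
    then obtain y z where yz: "x = y * z" "y dvd p ^ k" "z dvd m" by (rule dvd_productE)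
    then obtain i where "i \<le> k" "y = p ^ i" using divides_primepow_nat[OF p] by blast
    with yz show "x \<in> (\<lambda>(i, e). p ^ i * e) ` ({..k} \<times> {e. e dvd m})" by force
  qed
  hence "(\<Sum>x | x dvd p ^ k * m. f x) = (\<Sum>(i, e)\<in>{..k} \<times> {e. e dvd m}. f (p ^ i * e))"
    by (subst sum.reindex_bij_betw [symmetric]) (auto simp: case_prod_unfold)
  also have "\<dots> = (\<Sum>i\<le>k. f p ^ i) * (\<Sum>e | e dvd m. f e)"
    by (simp add: sum_product sum.cartesian_product f pow)
  finally show ?thesis .
qed

text \<open>
  By multiplicativity the sum is a product of finite geometric sums with ratios in \<open>[-1, 1]\<close>.
\<close>

lemma sum_divisors_nonneg:
  fixes f :: "nat \<Rightarrow> real"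
  assumes f: "\<And>x y. f (x * y) = f x * f y" "f 1 = 1" "\<And>x. \<bar>f x\<bar> \<le> 1"
  shows "n > 0 \<Longrightarrow> (\<Sum>x | x dvd n. f x) \<ge> 0"
proof (induction n rule: less_induct)
  case (less n)
  show ?case
  proof (cases "n = 1")
    case True
    thus ?thesis using f(2) by simp
  next
    case False
    then obtain p where p: "prime p" "p dvd n" using prime_factor_nat by blast
    obtain m where m: "n = p ^ multiplicity p n * m" "\<not> p dvd m"
      using p less.prems by (metis multiplicity_decompose' not_prime_unit neq0_conv)
    have "multiplicity p n > 0" using p less.prems by (simp add: prime_multiplicity_gt_zero_iff)
    hence "p ^ multiplicity p n > 1" using p prime_gt_1_nat by (intro one_less_power) auto
    moreover have "m > 0" using m(2) by (intro Nat.gr0I) auto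
    ultimately have "m < n" by (subst m(1)) simp
    have "(\<Sum>i\<le>multiplicity p n. f p ^ i) \<ge> 0"
    proof (cases "f p = 1")
      case False
      have "f p ^ Suc (multiplicity p n) \<le> 1"
        using power_le_one[of "\<bar>f p\<bar>" "Suc (multiplicity p n)"] f(3)[of p]
        by (metis abs_ge_zero abs_le_D1 power_abs)
      thus ?thesis using f(3)[of p] False by (simp add: sum_gp0 abs_le_iff)
    qed simp
    moreover have "(\<Sum>x | x dvd m. f x) \<ge> 0" using less.IH \<open>m < n\<close> \<open>m > 0\<close> by simp
    ultimately show ?thesis
      by (subst m(1)) (simp add: sum_divisors_prime_power_times[OF p(1) m(2) f(1,2)])
  qed
qed

text \<open>
  Pairing the \<open>i\<close>-th term with the \<open>i\<close>-th from the end and using \<open>u\<^sup>2 + v\<^sup>2 \<ge> 2 u v\<close>.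
\<close>

lemma sum_even_powers_ge:
  fixes x :: real
  assumes "x \<ge> 0"
  shows "real m * x ^ (m - 1) \<le> (\<Sum>i<m. (x ^ 2) ^ i)"
proof -
  have pair: "2 * x ^ (m - 1) \<le> (x ^ 2) ^ i + (x ^ 2) ^ (m - Suc i)" if "i < m" for i
  proof -
    have "x ^ (m - 1) = x ^ i * x ^ (m - Suc i)"
      using that by (simp flip: power_add)
    moreover have "0 \<le> (x ^ i - x ^ (m - Suc i))\<^sup>2" by simp
    ultimately show ?thesis
      by (simp add: power2_eq_square power_mult_distrib algebra_simps)
  qed
  have "2 * (real m * x ^ (m - 1)) = (\<Sum>i<m. 2 * x ^ (m - 1))" by simp
  also have "\<dots> \<le> (\<Sum>i<m. (x ^ 2) ^ i + (x ^ 2) ^ (m - Suc i))"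
    by (intro sum_mono pair) auto
  also have "\<dots> = 2 * (\<Sum>i<m. (x ^ 2) ^ i)"
    using sum.nat_diff_reindex[of "\<lambda>i. (x ^ 2) ^ i" m] by (simp add: sum.distrib)
  finally show ?thesis by simp
qed

text \<open>
  The weights by which the Lambert kernel \<open>t ^ m / (1 - t ^ m)\<close> differs from \<open>1 / (m (1 - t))\<close>, its
  leading behaviour for \<open>t \<rightarrow> 1\<close>. With \<open>G m = 1 + t + \<dots> + t ^ (m - 1)\<close>, their monotonicity amounts to
  \<open>m (m + 1) t ^ m \<le> G m * G (m + 1)\<close>, which follows from the preceding lemma for \<open>x = sqrt t\<close>.
\<close>

lemma lambert_kernel:
  fixes t :: real
  assumes t: "0 < t" "t < 1" and m: "m > 0"
  defines "b \<equiv> \<lambda>m. 1 / (real m * (1 - t)) - t ^ m / (1 - t ^ m)"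
  shows "0 \<le> b m" and "b (Suc m) \<le> b m"
proof -
  define G where "G m = (\<Sum>i<m. t ^ i)" for m
  have G: "1 - t ^ m = (1 - t) * G m" for m
    unfolding G_def by (rule one_diff_power_eq)
  have Gpos: "G m > 0" if "m > 0" for m
    unfolding G_def using that t by (intro sum_pos) auto
  have "real m * t ^ m = (\<Sum>i<m. t ^ m)" by simp
  also have "\<dots> \<le> G m"
    unfolding G_def using t by (intro sum_mono power_decreasing) auto
  finally have "real m * t ^ m \<le> G m" .
  thus "0 \<le> b m"
    using t m Gpos[OF m] by (simp add: b_def G divide_simps mult_ac)
  have x: "t = sqrt t ^ 2" using t by simp
  have "real m * real (Suc m) * t ^ m \<le> real m * real (Suc m) * sqrt t ^ (2 * m - 1)"
  proof -
    have "t ^ m = sqrt t ^ (2 * m)" using t by (simp add: power_mult)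
    also have "\<dots> \<le> sqrt t ^ (2 * m - 1)" using t by (intro power_decreasing) auto
    finally show ?thesis by (intro mult_left_mono) auto
  qed
  also have "\<dots> = (real m * sqrt t ^ (m - 1)) * (real (Suc m) * sqrt t ^ (Suc m - 1))"
    using m by (simp flip: power_add add: mult_2)
  also have "\<dots> \<le> G m * G (Suc m)"
    using sum_even_powers_ge[of "sqrt t" m] sum_even_powers_ge[of "sqrt t" "Suc m"] t Gpos[OF m]
    unfolding G_def x [symmetric] by (intro mult_mono) auto
  finally have key: "real m * real (Suc m) * t ^ m \<le> G m * G (Suc m)" .
  have nz: "G m > 0" "G (Suc m) > 0" "1 - t > 0" "real m > 0" using Gpos m t by auto
  have "t ^ m / (1 - t ^ m) - t ^ Suc m / (1 - t ^ Suc m) =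
        (t ^ m - t ^ Suc m) / ((1 - t ^ m) * (1 - t ^ Suc m))"
  proof -
    have "1 - t ^ m \<noteq> 0" "1 - t ^ Suc m \<noteq> 0" unfolding G using nz by auto
    moreover have "A / (1 - A) - B / (1 - B) = (A - B) / ((1 - A) * (1 - B))"
      if "1 - A \<noteq> 0" "1 - B \<noteq> 0" for A B :: real
      using that by (simp add: field_simps)
    ultimately show ?thesis by blast
  qed
  also have "\<dots> = (t ^ m * (1 - t)) / ((1 - t) * G m * ((1 - t) * G (Suc m)))"
    unfolding G by (simp add: algebra_simps)
  also have "\<dots> = (t ^ m / (G m * G (Suc m))) / (1 - t)" using nz by (simp add: divide_simps)
  also have "\<dots> \<le> (1 / (real m * real (Suc m))) / (1 - t)"
    using key nz by (intro divide_right_mono) (simp_all add: divide_simps mult_ac)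
  also have "\<dots> = 1 / (real m * (1 - t)) - 1 / (real (Suc m) * (1 - t))"
    using nz by (simp add: divide_simps)
  finally show "b (Suc m) \<le> b m" by (simp add: b_def)
qed

lemma lambert_series:
  fixes a :: "nat \<Rightarrow> complex"
  assumes a: "\<And>n. norm (a n) \<le> 1" and t: "0 < t" "t < (1::real)"
  obtains S where "((\<lambda>n. (\<Sum>m | m dvd n. a m) * of_real (t ^ n)) has_sum S) {1..}"
    and "((\<lambda>m. a m * of_real (t ^ m / (1 - t ^ m))) has_sum S) {1..}"
proof -
  define F where "F m k = a m * of_real (t ^ (m * k))" for m k
  have geo: "((\<lambda>k. t ^ (m * k)) has_sum (t ^ m / (1 - t ^ m))) {1..}" if "m \<ge> 1" for m
  proof -
    have "t ^ m < 1" using that t power_strict_decreasing[of 0 m t] by simp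
    thus ?thesis using has_sum_geometric_from_1[of "t ^ m"] t by (simp add: power_mult)
  qed
  have "(\<lambda>(m, k). t ^ (m * k)) summable_on ({1..} \<times> {1..})"
  proof (rule summable_on_SigmaI[where g = "\<lambda>m. t ^ m / (1 - t ^ m)"])
    have "(\<lambda>m. t ^ m * (1 / (1 - t))) summable_on {1..}"
      using has_sum_geometric_from_1[of t] t
      by (intro summable_on_cmult_left has_sum_imp_summable) auto
    moreover have "norm (t ^ m / (1 - t ^ m)) \<le> t ^ m * (1 / (1 - t))" if "m \<in> {1..}" for m
    proof -
      have "t ^ m \<le> t ^ 1" using that t by (intro power_decreasing) auto
      thus ?thesis using t by (auto simp: abs_of_nonneg power_le_one intro!: divide_left_mono mult_pos_pos)
    qed
    ultimately show "(\<lambda>m. t ^ m / (1 - t ^ m)) summable_on {1..}"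
      by (rule abs_summable_summable[OF abs_summable_on_comparison_test'])
  qed (use geo t in auto)
  moreover have "norm (case x of (m, k) \<Rightarrow> F m k) \<le> (case x of (m, k) \<Rightarrow> t ^ (m * k))" for x
    using a t by (auto simp: F_def norm_mult norm_power intro!: mult_left_le_one_le split: prod.split)
  ultimately have "(\<lambda>(m, k). F m k) summable_on ({1..} \<times> {1..})"
    by (rule abs_summable_summable[OF abs_summable_on_comparison_test'])
  then obtain S where S: "((\<lambda>(m, k). F m k) has_sum S) ({1..} \<times> {1..})"
    unfolding summable_on_def by blast
  show ?thesis
  proof
    have "(\<Sum>m | m dvd n. F m (n div m)) = (\<Sum>m | m dvd n. a m) * of_real (t ^ n)" for n
      by (simp add: F_def sum_distrib_right)
    thus "((\<lambda>n. (\<Sum>m | m dvd n. a m) * of_real (t ^ n)) has_sum S) {1..}"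
      using has_sum_divisors[OF S] by simp
    show "((\<lambda>m. a m * of_real (t ^ m / (1 - t ^ m))) has_sum S) {1..}"
    proof (rule has_sum_SigmaD[OF S])
      fix m :: nat assume "m \<in> {1..}"
      hence "((\<lambda>k. of_real (t ^ (m * k))) has_sum complex_of_real (t ^ m / (1 - t ^ m))) {1..}"
        by (intro has_sum_of_real geo) auto
      thus "((\<lambda>k. case (m, k) of (m, k) \<Rightarrow> F m k) has_sum a m * of_real (t ^ m / (1 - t ^ m))) {1..}"
        unfolding F_def prod.case by (rule has_sum_cmult_right)
    qed
  qed
qed

context nonprincipal_char
begin

text \<open>
  If \<open>L(1, \<chi>) = 0\<close>, then subtracting the vanishing series of \<open>\<chi> m / (m (1 - t))\<close> replaces the kernel by
  the decreasing weights \<open>b m\<close>, the first of which is 1 for every \<open>t\<close>. Hence the bound does not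
  depend on \<open>t\<close>.
\<close>

lemma lambert_series_bound:
  assumes L1: "dirichlet_series \<chi> 1 = 0" and "d > 1" and t: "0 < t" "t < 1"
    and S: "((\<lambda>m. \<chi> m * of_real (t ^ m / (1 - t ^ m))) has_sum S) {1..}"
  shows "norm S \<le> 2 * real d"
proof -
  define b where "b m = 1 / (real m * (1 - t)) - t ^ m / (1 - t ^ m)" for m
  have \<chi>0: "\<chi> 0 = 0" using dirichlet_char_eq_0_iff[OF char, of 0] \<open>d > 1\<close> by simp
  have "(\<lambda>m. \<chi> m * of_real (t ^ m / (1 - t ^ m))) sums S"
    using S by (rule sums_from_1) (simp add: \<chi>0)
  moreover have "(\<lambda>m. \<chi> m * of_real (real m powr - 1)) sums 0"
    using summable_L[of 1] L1 by (simp add: dirichlet_series_def sums_iff)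
  hence "(\<lambda>m. of_real (1 / (1 - t)) * (\<chi> m * of_real (real m powr - 1))) sums (of_real (1 / (1 - t)) * 0)"
    by (rule sums_mult)
  ultimately have "(\<lambda>m. of_real (1 / (1 - t)) * (\<chi> m * of_real (real m powr - 1)) -
      \<chi> m * of_real (t ^ m / (1 - t ^ m))) sums (of_real (1 / (1 - t)) * 0 - S)"
    by (intro sums_diff)
  moreover have "of_real (1 / (1 - t)) * (\<chi> m * of_real (real m powr - 1)) -
      \<chi> m * of_real (t ^ m / (1 - t ^ m)) = b m *\<^sub>R \<chi> m" for m
  proof -
    have "b m = 1 / (1 - t) * real m powr - 1 - t ^ m / (1 - t ^ m)"
      by (simp add: b_def powr_minus divide_simps)
    hence *: "complex_of_real (b m) =
        of_real (1 / (1 - t)) * of_real (real m powr - 1) - of_real (t ^ m / (1 - t ^ m))"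
      by (simp only: of_real_mult of_real_diff)
    show ?thesis unfolding scaleR_conv_of_real * by (simp only: algebra_simps)
  qed
  ultimately have "(\<lambda>m. b m *\<^sub>R \<chi> m) sums - S" by simp
  hence "(\<lambda>N. norm (\<Sum>m<N. b m *\<^sub>R \<chi> m)) \<longlonglongrightarrow> norm (- S)"
    unfolding sums_def by (rule tendsto_norm)
  moreover have "norm (\<Sum>m<N. b m *\<^sub>R \<chi> m) \<le> 2 * real d" for N
  proof -
    have "(\<Sum>m<N. b m *\<^sub>R \<chi> m) = (\<Sum>m=1..<N. b m *\<^sub>R \<chi> m)"
      by (rule sum.mono_neutral_right) (auto simp: \<chi>0 not_le)
    also have "norm \<dots> \<le> 2 * real d * b 1"
      using lambert_kernel[OF t] norm_sum_dirichlet_char_le[OF char d nonprincipal]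
      by (intro norm_sum_mult_antimono_le) (auto simp: b_def)
    also have "b 1 = 1" using t by (simp add: b_def flip: diff_divide_distrib)
    finally show ?thesis by simp
  qed
  ultimately have "norm (- S) \<le> 2 * real d" by (intro LIMSEQ_le_const2) auto
  thus ?thesis by simp
qed

text \<open>
  Monsky's argument. Let \<open>r n\<close> be the sum of \<open>\<chi>\<close> over the divisors of \<open>n\<close>. The Lambert series of \<open>\<chi>\<close> is
  the power series with the coefficients \<open>r n\<close>. They are nonnegative, and they equal 1 at all powers
  of a prime \<open>q\<close> dividing \<open>d\<close>. So the series is unbounded for \<open>t \<rightarrow> 1\<close>, whereas \<open>L(1, \<chi>) = 0\<close> would bound
  it by \<open>2 * d\<close>; using \<open>2 * d + 1\<close> powers of \<open>q\<close> gives the contradiction.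
\<close>

theorem L_1_nonzero_real:
  assumes real: "\<And>n. \<chi> n \<in> \<real>" and d1: "d > 1"
  shows "dirichlet_series \<chi> 1 \<noteq> 0"
proof
  assume L1: "dirichlet_series \<chi> 1 = 0"
  define f where "f n = Re (\<chi> n)" for n
  have \<chi>f: "\<chi> n = of_real (f n)" for n using real[of n] by (simp add: f_def complex_is_Real_iff complex_eq_iff)
  have f: "f (x * y) = f x * f y" "f 1 = 1" "\<bar>f x\<bar> \<le> 1" for x y
  proof -
    have "complex_of_real (f (x * y)) = of_real (f x * f y)"
      using dirichlet_char_mult[OF char, of x y] by (simp add: \<chi>f)
    thus "f (x * y) = f x * f y" by (simp only: of_real_eq_iff)
    show "f 1 = 1" using dirichlet_char_1[OF char] by (simp add: f_def)
    show "\<bar>f x\<bar> \<le> 1"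
      using norm_dirichlet_char[OF char d, of x] by (simp add: \<chi>f split: if_splits)
  qed
  define r where "r n = (\<Sum>x | x dvd n. f x)" for n
  have r_nonneg: "r n \<ge> 0" if "n > 0" for n
    unfolding r_def using sum_divisors_nonneg[OF f that] .
  obtain q where q: "prime q" "q dvd d" using d1 prime_factor_nat[of d] by auto
  have "\<not> coprime q d" using q by (metis coprime_absorb_left not_prime_unit)
  hence fq: "f q = 0" using dirichlet_char_eq_0_iff[OF char, of q] by (simp add: \<chi>f)
  have "\<not> q dvd 1" using q(1) by auto
  hence r_q: "r (q ^ k) = 1" for k
    using sum_divisors_prime_power_times[OF q(1) _ f(1,2), of 1 k] f(2)
    by (simp add: r_def fq sum_gp0)
  let ?J = "2 * d + 1"
  have bound: "(\<Sum>j<?J. t ^ (q ^ j)) \<le> 2 * real d" if t: "0 < t" "t < 1" for t :: real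
  proof -
    have \<chi>1: "norm (\<chi> n) \<le> 1" for n using f(3)[of n] by (simp add: \<chi>f)
    obtain S where S: "((\<lambda>n. (\<Sum>m | m dvd n. \<chi> m) * of_real (t ^ n)) has_sum S) {1..}"
      "((\<lambda>m. \<chi> m * of_real (t ^ m / (1 - t ^ m))) has_sum S) {1..}"
      by (rule lambert_series[OF \<chi>1 t])
    have "((\<lambda>n. Re ((\<Sum>m | m dvd n. \<chi> m) * of_real (t ^ n))) has_sum Re S) {1..}"
      by (rule has_sum_Re[OF S(1)])
    moreover have "Re ((\<Sum>m | m dvd n. \<chi> m) * of_real (t ^ n)) = r n * t ^ n" for n
      by (simp add: \<chi>f r_def flip: of_real_sum of_real_mult of_real_power)
    ultimately have "((\<lambda>n. r n * t ^ n) has_sum Re S) {1..}" by (simp only:)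
    hence "(\<Sum>n\<in>(\<lambda>j. q ^ j) ` {..<?J}. r n * t ^ n) \<le> Re S"
    proof (rule finite_sum_le_has_sum)
      show "(\<lambda>j. q ^ j) ` {..<?J} \<subseteq> {1..}"
        using prime_gt_0_nat[OF q(1)] by (auto simp: Suc_le_eq)
      show "r n * t ^ n \<ge> 0" if "n \<in> {1..} - (\<lambda>j. q ^ j) ` {..<?J}" for n
        using that t by (intro mult_nonneg_nonneg r_nonneg) auto
    qed simp
    also have "Re S \<le> norm S" by (rule complex_Re_le_cmod)
    also have "\<dots> \<le> 2 * real d" by (rule lambert_series_bound[OF L1 d1 t S(2)])
    also have "(\<Sum>n\<in>(\<lambda>j. q ^ j) ` {..<?J}. r n * t ^ n) = (\<Sum>j<?J. t ^ (q ^ j))"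
      using prime_gt_1_nat[OF q(1)] by (subst sum.reindex) (auto simp: r_q inj_on_def)
    finally show ?thesis .
  qed
  have "((\<lambda>t. \<Sum>j<?J. t ^ (q ^ j)) \<longlongrightarrow> (\<Sum>j<?J. 1 ^ (q ^ j))) (at_left (1::real))"
    by (intro tendsto_intros)
  moreover have "eventually (\<lambda>t. (\<Sum>j<?J. t ^ (q ^ j)) \<le> 2 * real d) (at_left (1::real))"
    unfolding eventually_at_left_field by (rule exI[of _ 0]) (use bound in auto)
  ultimately have "(\<Sum>j<?J. 1 ^ (q ^ j)) \<le> 2 * real d"
    by (intro tendsto_upperbound[of _ _ "at_left 1"]) auto
  thus False by simp
qed

end

section \<open>Primes in arithmetic progressions\<close>

text \<open>
  If the square of a character is principal, then its values are 0, 1 and -1.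
\<close>

theorem (in nonprincipal_char) L_1_nonzero:
  assumes "d > 1"
  shows "dirichlet_series \<chi> 1 \<noteq> 0"
proof (cases "(\<lambda>n. \<chi> n ^ 2) = principal_char d")
  case False
  have "dirichlet_char d (\<lambda>n. \<chi> n ^ 2)"
    using dirichlet_char_times[OF char char] by (simp add: power2_eq_square)
  thus ?thesis
    using False d by (intro L_1_nonzero_nonreal[of d] nonprincipal_char_axioms) (unfold_locales)
next
  case True
  have "\<chi> n \<in> \<real>" for n
  proof -
    have "\<chi> n ^ 2 = 0 \<or> \<chi> n ^ 2 = 1"
      using fun_cong[OF True, of n] by (simp add: principal_char_def split: if_splits)
    hence "\<chi> n = 0 \<or> \<chi> n = 1 \<or> \<chi> n = - 1" by (auto simp: power2_eq_1_iff)
    thus ?thesis by auto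
  qed
  thus ?thesis using assms by (rule L_1_nonzero_real)
qed

text \<open>
  The product of the von Mangoldt series with \<open>L\<close> is \<open>- L'\<close>, which is bounded, and \<open>L\<close> tends to
  \<open>L(1, \<chi>) \<noteq> 0\<close>.
\<close>

theorem (in nonprincipal_char) mangoldt_series_bounded:
  assumes "d > 1"
  shows "mangoldt_series \<chi> \<in> O[at_right 1](\<lambda>_. 1)"
proof -
  let ?L = "dirichlet_series \<chi>" and ?D = "dirichlet_series (\<lambda>n. \<chi> n * of_real (ln (real n)))"
  have le1: "norm (\<chi> n) \<le> 1" for n by (rule norm_dirichlet_char_le_1[OF char d])
  have D: "norm (?D s) \<le> 3 + 2 * real d" if s: "s > 1" for s
  proof (rule LIMSEQ_le_const2)
    show "(\<lambda>N. norm (\<Sum>n<N. \<chi> n * of_real (ln (real n)) * of_real (real n powr - s))) \<longlonglongrightarrow> norm (?D s)"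
      unfolding dirichlet_series_def by (intro tendsto_norm summable_LIMSEQ summable_ln_coeffs[OF le1 s])
  qed (use norm_sum_ln_le[of s] s in auto)
  have nz: "?L 1 \<noteq> 0" by (rule L_1_nonzero[OF assms])
  hence "eventually (\<lambda>s. norm (?L s) > norm (?L 1) / 2) (at_right 1)"
    by (intro order_tendstoD(1)[OF tendsto_norm[OF tendsto_L]]) auto
  moreover have "eventually (\<lambda>s::real. s > 1) (at_right 1)" by (rule eventually_at_right_less)
  ultimately have "eventually (\<lambda>s. norm (mangoldt_series \<chi> s) \<le>
      (3 + 2 * real d) / (norm (?L 1) / 2) * norm (1::complex)) (at_right 1)"
  proof eventually_elim
    case (elim s)
    have Lpos: "norm (?L 1) / 2 > 0" using nz by simp
    have "norm (mangoldt_series \<chi> s) * (norm (?L 1) / 2) \<le> norm (mangoldt_series \<chi> s) * norm (?L s)"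
      using elim by (intro mult_left_mono) auto
    also have "\<dots> = norm (?D s)"
      by (simp add: mangoldt_series_mult_L[OF char d elim(2)] flip: norm_mult)
    also have "\<dots> \<le> 3 + 2 * real d" by (rule D[OF elim(2)])
    finally show ?case using Lpos by (simp add: pos_le_divide_eq)
  qed
  thus ?thesis by (rule bigoI)
qed

text \<open>
  The numbers \<open>j * d + 1\<close> alone make the series diverge, by comparison with the harmonic series.
\<close>

lemma not_summable_coprime_inverse:
  assumes "d > 0"
  shows "\<not> summable (\<lambda>n. if coprime n d then inverse (real n) else 0)"
proof
  assume "summable (\<lambda>n. if coprime n d then inverse (real n) else 0)"
  hence "summable ((\<lambda>n. if coprime n d then inverse (real n) else 0) \<circ> (\<lambda>j. j * d + 1))"
    by (rule summable_reindex) (use assms in \<open>auto simp: inj_def\<close>)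
  moreover have "coprime (j * d + 1) d" for j
    by (metis coprime_1_left coprime_iff_gcd_eq_1 gcd_add_mult mult.commute add.commute gcd.commute)
  ultimately have "summable (\<lambda>j. inverse (real (j * d + 1)))" by (simp add: o_def)
  hence "summable (\<lambda>j. real d * inverse (real (j * d + 1)))" by (rule summable_mult)
  hence "summable (\<lambda>j. inverse (real (Suc j)))"
  proof (rule summable_comparison_test'[where N = 0])
    fix j
    have "real (j * d + 1) \<le> real d * real (Suc j)" using assms by (simp add: algebra_simps)
    moreover have "real (j * d + 1) > 0" by (simp only: of_nat_0_less_iff)
    ultimately have "real d / (real d * real (Suc j)) \<le> real d / real (j * d + 1)"
      by (intro divide_left_mono mult_pos_pos) (use assms in auto)
    moreover have "real d / (real d * real (Suc j)) = norm (inverse (real (Suc j)))"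
      using assms by (simp add: inverse_eq_divide)
    ultimately show "norm (inverse (real (Suc j))) \<le> real d * inverse (real (j * d + 1))"
      by (simp only: divide_inverse)
  qed
  hence "summable (\<lambda>j. inverse (real j))" by (subst (asm) summable_Suc_iff)
  thus False using not_summable_harmonic[where ?'a = real] by simp
qed

text \<open>
  If the series were bounded by \<open>K\<close> near 1, then by the differential equation for \<open>|L|\<^sup>2\<close> the function
  \<open>|L(s)|\<^sup>2 exp (2 K s)\<close> would be nondecreasing, so \<open>L\<close> would be bounded near 1. For the principal
  character \<open>L\<close> dominates its partial sums, and letting \<open>s \<rightarrow> 1\<close> in those would bound the partial sums
  of the divergent series of reciprocals of the numbers coprime to \<open>d\<close>.
\<close>

theorem mangoldt_series_principal_unbounded:
  assumes d: "d > 0"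
  shows "mangoldt_series (principal_char d) \<notin> O[at_right 1](\<lambda>_. 1)"
proof
  let ?\<chi> = "principal_char d"
  let ?A = "mangoldt_series ?\<chi>" and ?L = "dirichlet_series ?\<chi>"
  assume "?A \<in> O[at_right 1](\<lambda>_. 1)"
  then obtain K where "eventually (\<lambda>s. norm (?A s) \<le> K) (at_right 1)"
    by (elim landau_o.bigE) auto
  then obtain s0 where s0: "s0 > 1" "\<And>s. 1 < s \<Longrightarrow> s < s0 \<Longrightarrow> norm (?A s) \<le> K"
    unfolding eventually_at_right_field by blast
  define s1 where "s1 = (1 + s0) / 2"
  have s1: "1 < s1" "s1 < s0" using s0(1) by (simp_all add: s1_def)
  define u where "u = (\<lambda>s. (norm (?L s))\<^sup>2 * exp (2 * K * s))"
  have mono: "u s \<le> u s1" if s: "1 < s" "s \<le> s1" for s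
  proof (rule DERIV_nonneg_imp_nondecreasing[OF s(2)])
    fix x assume x: "s \<le> x" "x \<le> s1"
    hence x': "1 < x" "x < s0" using s s1 by auto
    have "((\<lambda>s. exp (2 * K * s)) has_real_derivative 2 * K * exp (2 * K * x)) (at x)"
      by (auto intro!: derivative_eq_intros)
    from DERIV_mult[OF DERIV_norm_L_squared[OF dirichlet_char_principal d x'(1)] this]
    have "(u has_real_derivative 2 * (K - Re (?A x)) * u x) (at x)"
      unfolding u_def by (rule DERIV_cong) (simp add: algebra_simps)
    moreover have "Re (?A x) \<le> K"
      using s0(2)[OF x'] complex_Re_le_cmod[of "?A x"] by linarith
    hence "0 \<le> 2 * (K - Re (?A x)) * u x" by (simp add: u_def)
    ultimately show "\<exists>y. (u has_real_derivative y) (at x) \<and> 0 \<le> y" by blast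
  qed
  have K: "K \<ge> 0" using s0(2)[of s1] s1 norm_ge_zero[of "?A s1"] by linarith
  have L_bound: "norm (?L s) \<le> sqrt (u s1)" if s: "1 < s" "s \<le> s1" for s
  proof -
    have "(norm (?L s))\<^sup>2 * 1 \<le> u s"
      unfolding u_def using K s by (intro mult_left_mono) auto
    thus ?thesis using mono[OF s] by (intro real_le_rsqrt) simp
  qed
  define h where "h n = (if coprime n d then inverse (real n) else 0)" for n
  have "(\<Sum>n<N. h n) \<le> sqrt (u s1)" for N
  proof -
    let ?P = "\<lambda>s. \<Sum>n<N. Re (?\<chi> n * of_real (real n powr - s))"
    have "((\<lambda>s. ?P s) \<longlongrightarrow> (\<Sum>n<N. if n = 0 then 0 else Re (?\<chi> n * of_real (real n powr - 1)))) (at_right 1)"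
    proof (rule tendsto_sum)
      fix n
      show "((\<lambda>s. Re (?\<chi> n * of_real (real n powr - s))) \<longlongrightarrow>
              (if n = 0 then 0 else Re (?\<chi> n * of_real (real n powr - 1)))) (at_right 1)"
        by (cases "n = 0") (auto intro!: tendsto_eq_intros)
    qed
    also have "(\<Sum>n<N. if n = 0 then 0 else Re (?\<chi> n * of_real (real n powr - 1))) = (\<Sum>n<N. h n)"
      by (intro sum.cong) (auto simp: h_def principal_char_def powr_minus power2_eq_square divide_simps)
    finally have lim: "((\<lambda>s. ?P s) \<longlongrightarrow> (\<Sum>n<N. h n)) (at_right 1)" .
    have "?P s \<le> sqrt (u s1)" if s: "1 < s" "s < s1" for s
    proof -
      have sm: "summable (\<lambda>n. ?\<chi> n * of_real (real n powr - s))"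
        by (rule summable_norm_cancel[OF summable_bounded_coeffs[OF norm_dirichlet_char_le_1[OF dirichlet_char_principal d] s(1)]])
      have "?P s \<le> (\<Sum>n. Re (?\<chi> n * of_real (real n powr - s)))"
        by (rule sum_le_suminf[OF summable_Re[OF sm]]) (auto simp: principal_char_def)
      also have "\<dots> = Re (?L s)" unfolding dirichlet_series_def using Re_suminf[OF sm] by simp
      also have "\<dots> \<le> norm (?L s)" by (rule complex_Re_le_cmod)
      also have "\<dots> \<le> sqrt (u s1)" using L_bound s by simp
      finally show ?thesis .
    qed
    hence "eventually (\<lambda>s. ?P s \<le> sqrt (u s1)) (at_right 1)"
      unfolding eventually_at_right_field using s1(1) by blast
    with lim show ?thesis by (intro tendsto_upperbound[of _ _ "at_right 1"]) auto
  qed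
  moreover have "0 \<le> h n" for n by (simp add: h_def)
  ultimately have "summable h" by (intro summableI_nonneg_bounded)
  thus False using not_summable_coprime_inverse[OF d] unfolding h_def by blast
qed

text \<open>
  The denominator counts the units, so this is the mean over the unit group.
\<close>

definition residue_mean :: "nat \<Rightarrow> (nat \<Rightarrow> complex) \<Rightarrow> complex" where
  "residue_mean d f = (\<Sum>n<d. f n) / (\<Sum>n<d. principal_char d n)"

lemma sum_principal_char_nonzero:
  assumes "d > 1"
  shows "(\<Sum>n<d. principal_char d n) \<noteq> 0"
proof -
  have "(\<Sum>n<d. principal_char d n) = of_nat (card {n. n < d \<and> coprime n d})"
    by (simp add: principal_char_def sum.If_cases Int_def)
  moreover have "1 \<in> {n. n < d \<and> coprime n d}" using assms by simp
  hence "card {n. n < d \<and> coprime n d} \<noteq> 0" by (subst card_0_eq) auto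
  ultimately show ?thesis by simp
qed

text \<open>
  The difference is linear in \<open>f\<close>, so it suffices to consider multiples of characters. For the principal
  character the difference is zero; for any other the mean is zero and the von Mangoldt series is
  bounded. The induction carries along that \<open>f\<close> is bounded, which makes the series converge
  and hence additive.
\<close>

theorem mangoldt_series_residue_function:
  assumes "residue_function d f" and d: "d > 1"
  shows "(\<lambda>s. mangoldt_series f s - residue_mean d f * mangoldt_series (principal_char d) s)
           \<in> O[at_right 1](\<lambda>_. 1)"
proof -
  let ?A0 = "mangoldt_series (principal_char d)"
  have s1: "eventually (\<lambda>s::real. s > 1) (at_right 1)" by (rule eventually_at_right_less)
  have "(\<exists>C. \<forall>n. norm (f n) \<le> C) \<and>
    (\<lambda>s. mangoldt_series f s - residue_mean d f * ?A0 s) \<in> O[at_right 1](\<lambda>_. 1)"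
    using assms
  proof (induction rule: residue_function_induct)
    case (add f g)
    from add obtain C C' where C: "\<And>n. norm (f n) \<le> C" "\<And>n. norm (g n) \<le> C'" by blast
    have "norm (f n + g n) \<le> C + C'" for n using C by (intro norm_triangle_mono)
    hence bounded: "\<exists>C. \<forall>n. norm (f n + g n) \<le> C" by blast
    have sum: "(\<lambda>s. (mangoldt_series f s - residue_mean d f * ?A0 s) +
        (mangoldt_series g s - residue_mean d g * ?A0 s)) \<in> O[at_right 1](\<lambda>_. 1)"
      by (rule sum_in_bigo(1)) (use add in blast)+
    have "eventually (\<lambda>s. (mangoldt_series f s - residue_mean d f * ?A0 s) +
        (mangoldt_series g s - residue_mean d g * ?A0 s) =
        mangoldt_series (\<lambda>n. f n + g n) s - residue_mean d (\<lambda>n. f n + g n) * ?A0 s) (at_right 1)"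
      using s1
      by eventually_elim
         (simp add: mangoldt_series_add[OF C] residue_mean_def sum.distrib add_divide_distrib algebra_simps)
    from iffD1[OF landau_o.big.in_cong[OF this] sum] bounded show ?case by (intro conjI)
  next
    case (char c \<chi>)
    have d0: "d > 0" using d by simp
    have le1: "norm (\<chi> n) \<le> 1" for n by (rule norm_dirichlet_char_le_1[OF char d0])
    have "norm (c * \<chi> n) \<le> norm c" for n
      using mult_left_mono[OF le1[of n], of "norm c"] by (simp add: norm_mult)
    moreover have "(\<lambda>s. mangoldt_series (\<lambda>n. c * \<chi> n) s - residue_mean d (\<lambda>n. c * \<chi> n) * ?A0 s)
        \<in> O[at_right 1](\<lambda>_. 1)"
    proof (cases "\<chi> = principal_char d")
      case True
      have mean: "residue_mean d (\<lambda>n. c * \<chi> n) = c"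
        using sum_principal_char_nonzero[OF d] True
        by (simp add: residue_mean_def flip: sum_distrib_left)
      have "eventually (\<lambda>s. mangoldt_series (\<lambda>n. c * \<chi> n) s - residue_mean d (\<lambda>n. c * \<chi> n) * ?A0 s = 0) (at_right 1)"
        using s1 by eventually_elim (simp add: mean mangoldt_series_cmult[OF le1], simp add: True)
      from landau_o.big.in_cong[OF this] show ?thesis by simp
    next
      case False
      then interpret nonprincipal_char d \<chi> using char d0 by unfold_locales
      have mean: "residue_mean d (\<lambda>n. c * \<chi> n) = 0"
        using sum_dirichlet_char_period[OF char d0 False]
        by (simp add: residue_mean_def flip: sum_distrib_left)
      have eq: "eventually (\<lambda>s. mangoldt_series (\<lambda>n. c * \<chi> n) s - residue_mean d (\<lambda>n. c * \<chi> n) * ?A0 s =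
               c * mangoldt_series \<chi> s) (at_right 1)"
        using s1 by eventually_elim (simp add: mean mangoldt_series_cmult[OF le1])
      have "(\<lambda>s. c * mangoldt_series \<chi> s) \<in> O[at_right 1](\<lambda>_. 1)"
        using mangoldt_series_bounded[OF assms(2)] by simp
      from iffD2[OF landau_o.big.in_cong[OF eq] this] show ?thesis .
    qed
    ultimately show ?case by blast
  qed
  thus ?thesis by blast
qed

text \<open>
  The proper prime powers \<open>p ^ k\<close> contribute at most the sum over \<open>p\<close> and \<open>k \<ge> 2\<close> of \<open>ln p / p ^ k\<close>; the
  geometric sum over \<open>k\<close> is at most \<open>2 / p\<^sup>2\<close>.
\<close>

lemma summable_mangoldt_nonprime:
  "summable (\<lambda>n. if prime n then 0 else mangoldt n / real n :: real)"
proof (rule summableI_nonneg_bounded)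
  fix N :: nat
  define C where "C = (\<Sum>p. 2 * (ln (real p) * real p powr - 2))"
  define G where "G = {p. prime p \<and> p < N} \<times> {2..N}"
  let ?h = "\<lambda>n. mangoldt n / real n :: real"
  have fin: "finite G" by (auto simp: G_def)
  have "(\<Sum>n<N. if prime n then 0 else ?h n) = (\<Sum>n | n < N \<and> \<not> prime n \<and> primepow n. ?h n)"
    by (rule sum.mono_neutral_cong_right) (auto simp: mangoldt_def)
  also have "\<dots> \<le> (\<Sum>n\<in>(\<lambda>(p, k). p ^ k) ` G. ?h n)"
  proof (rule sum_mono2)
    show "{n. n < N \<and> \<not> prime n \<and> primepow n} \<subseteq> (\<lambda>(p, k). p ^ k) ` G"
    proof safe
      fix n :: nat assume n: "n < N" "\<not> prime n" "primepow n"
      then obtain p k where pk: "prime p" "k > 0" "n = p ^ k" by (auto simp: primepow_def)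
      have "k \<noteq> 1" using n pk by auto
      moreover have "k < p ^ k" using pk prime_gt_1_nat by (intro power_gt_expt) auto
      moreover have "p \<le> p ^ k" using pk prime_gt_0_nat by (intro self_le_power) (auto simp: Suc_le_eq)
      ultimately have "(p, k) \<in> G" using n pk by (auto simp: G_def)
      thus "n \<in> (\<lambda>(p, k). p ^ k) ` G" using pk by force
    qed
  qed (use fin in \<open>auto simp: mangoldt_nonneg\<close>)
  also have "\<dots> \<le> (\<Sum>(p, k)\<in>G. ?h (p ^ k))"
    using sum_image_le[OF fin, of ?h "\<lambda>(p, k). p ^ k"]
    by (auto simp: mangoldt_nonneg o_def case_prod_unfold)
  also have "\<dots> = (\<Sum>p | prime p \<and> p < N. \<Sum>k=2..N. ln (real p) * (1 / real p) ^ k)"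
    unfolding G_def by (subst sum.cartesian_product [symmetric])
      (auto intro!: sum.cong simp: power_divide)
  also have "\<dots> \<le> (\<Sum>p | prime p \<and> p < N. 2 * (ln (real p) * real p powr - 2))"
  proof (rule sum_mono)
    fix p assume "p \<in> {p. prime p \<and> p < N}"
    hence p: "p \<ge> 2" by (auto simp: prime_ge_2_nat)
    define x where "x = 1 / real p"
    have x: "0 < x" "x \<le> 1 / 2" using p by (auto simp: x_def field_simps)
    have "(\<Sum>k=2..N. x ^ k) \<le> 2 * x ^ 2"
    proof (cases "N \<ge> 2")
      case True
      have "(1 - x) * (\<Sum>k=2..N. x ^ k) = x ^ 2 - x ^ Suc N" by (rule sum_gp_multiplied[OF True])
      also have "\<dots> \<le> x ^ 2" using x by simp
      finally have "(\<Sum>k=2..N. x ^ k) \<le> x ^ 2 / (1 - x)" using x by (simp add: field_simps)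
      also have "\<dots> \<le> x ^ 2 / (1 / 2)" using x by (intro divide_left_mono) auto
      finally show ?thesis by simp
    qed (use x in auto)
    hence "ln (real p) * (\<Sum>k=2..N. x ^ k) \<le> ln (real p) * (2 * x ^ 2)"
      using p by (intro mult_left_mono) auto
    moreover have "x ^ 2 = real p powr - 2"
      using p by (simp add: x_def powr_minus power_divide divide_simps powr_numeral)
    ultimately show "(\<Sum>k=2..N. ln (real p) * (1 / real p) ^ k) \<le> 2 * (ln (real p) * real p powr - 2)"
      by (simp add: x_def sum_distrib_left)
  qed
  also have "\<dots> \<le> C"
    unfolding C_def
  proof (rule sum_le_suminf)
    show "summable (\<lambda>p. 2 * (ln (real p) * real p powr - 2))"
      by (intro summable_mult summable_ln_powr) auto
    show "0 \<le> 2 * (ln (real p) * real p powr - 2)" for p by (cases "p = 0") auto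
  qed auto
  finally show "(\<Sum>n<N. if prime n then 0 else ?h n) \<le> C" .
qed (auto simp: mangoldt_nonneg)

lemma mangoldt_series_bounded_if_finite_primes:
  assumes f: "\<And>n. norm (f n) \<le> 1" and fin: "finite {p. prime p \<and> f p \<noteq> 0}"
  shows "mangoldt_series f \<in> O[at_right 1](\<lambda>_. 1)"
proof -
  define P where "P = {p. prime p \<and> f p \<noteq> 0}"
  \<comment> \<open>\<open>n powr - s\<close> is estimated by 1 at the finitely many primes in \<open>P\<close> and by \<open>1 / n\<close> elsewhere\<close>
  define h :: "nat \<Rightarrow> real" where
    "h n = (if n \<in> P then mangoldt n else 0) + (if prime n then 0 else mangoldt n / real n)" for n
  have h: "summable h"
    unfolding h_def using fin
    by (intro summable_add summable_mangoldt_nonprime summable_finite[of P]) (auto simp: P_def)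
  have "norm (mangoldt_series f s) \<le> suminf h" if s: "s > 1" for s
    unfolding mangoldt_series_def dirichlet_series_def
  proof (rule norm_suminf_le[OF _ h])
    fix n
    show "norm (f n * mangoldt n * of_real (real n powr - s)) \<le> h n"
    proof (cases "n = 0")
      case False
      have le: "real n powr - s \<le> real n powr - 1" "real n powr - s \<le> real n powr 0"
        using s False by (intro powr_mono; simp)+
      have 1: "norm (f n) * mangoldt n \<le> mangoldt n"
        using f[of n] by (intro mult_left_le_one_le) (auto simp: mangoldt_nonneg)
      have "norm (f n) * mangoldt n * real n powr - s \<le> mangoldt n * real n powr - s"
        using 1 by (intro mult_right_mono) auto
      moreover have "mangoldt n * real n powr - s \<le> mangoldt n * 1"
        using le False by (intro mult_left_mono) (auto simp: mangoldt_nonneg)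
      moreover have "mangoldt n * real n powr - s \<le> mangoldt n * (1 / real n)"
        using le False by (intro mult_left_mono) (auto simp: mangoldt_nonneg powr_minus divide_inverse)
      ultimately show ?thesis
        by (auto simp: h_def P_def norm_mult mangoldt_nonneg)
    qed (auto simp: h_def)
  qed
  hence "eventually (\<lambda>s. norm (mangoldt_series f s) \<le> suminf h * norm (1::complex)) (at_right 1)"
    using eventually_at_right_less[of "1::real"] by (auto elim!: eventually_mono)
  thus ?thesis by (rule bigoI)
qed

text \<open>
  The indicator function of the class of \<open>a\<close> is a residue function of nonzero mean, so its von
  Mangoldt series is unbounded like that of the principal character.
\<close>

theorem dirichlet_infinite_primes:
  fixes a d :: nat
  assumes d: "d > 1" and "coprime a d"
  shows "infinite {p. prime p \<and> [p = a] (mod d)}"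
proof
  assume fin: "finite {p. prime p \<and> [p = a] (mod d)}"
  define f :: "nat \<Rightarrow> complex" where "f n = (if [n = a] (mod d) then 1 else 0)" for n
  let ?A0 = "mangoldt_series (principal_char d)"
  have f_residue: "residue_function d f"
    unfolding residue_function_def
  proof safe
    fix n assume "\<not> coprime n d"
    hence "\<not> [n = a] (mod d)" using assms(2) by (metis cong_imp_coprime cong_sym)
    thus "f n = 0" by (simp add: f_def)
  qed (simp add: f_def cong_def)
  have "(\<Sum>n<d. f n) = (\<Sum>n<d. if n = a mod d then 1 else 0)"
    by (intro sum.cong) (auto simp: f_def cong_def)
  also have "\<dots> = 1" using d by (simp add: sum.delta)
  finally have mean: "residue_mean d f \<noteq> 0"
    using sum_principal_char_nonzero[OF d] by (simp add: residue_mean_def)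
  have "{p. prime p \<and> f p \<noteq> 0} = {p. prime p \<and> [p = a] (mod d)}" by (auto simp: f_def)
  hence "mangoldt_series f \<in> O[at_right 1](\<lambda>_. 1)"
    using fin by (intro mangoldt_series_bounded_if_finite_primes) (auto simp: f_def)
  from sum_in_bigo(2)[OF this mangoldt_series_residue_function[OF f_residue d]]
  have "(\<lambda>s. residue_mean d f * ?A0 s) \<in> O[at_right 1](\<lambda>_. 1)" by simp
  hence "?A0 \<in> O[at_right 1](\<lambda>_. 1)" using mean by simp
  thus False using mangoldt_series_principal_unbounded[of d] d by simp
qed

text \<open>
  The condition \<open>m \<ge> 1\<close> excludes just one member \<open>a\<close> of the residue class.
\<close>

theorem theorem2p34:
  fixes a d :: nat
  assumes "1 \<le> a" and "a < d" and "gcd a d = 1"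
  shows "infinite {p::nat. prime p \<and> (\<exists>m::nat. m \<ge> 1 \<and> p = a + m * d)}"
proof
  let ?S = "{p::nat. prime p \<and> (\<exists>m::nat. m \<ge> 1 \<and> p = a + m * d)}"
  assume "finite ?S"
  moreover have "{p. prime p \<and> [p = a] (mod d)} \<subseteq> insert a ?S"
  proof safe
    fix p assume p: "prime p" "[p = a] (mod d)" "p \<noteq> a"
    have a: "p mod d = a" using p(2) assms(2) by (simp add: cong_def)
    hence "p = a + (p div d) * d" using div_mult_mod_eq[of p d] by simp
    moreover from this have "p div d \<ge> 1" using p(3) by (cases "p div d") auto
    ultimately show "\<exists>m\<ge>1. p = a + m * d" by blast
  qed
  ultimately have "finite {p. prime p \<and> [p = a] (mod d)}" by (meson finite_insert finite_subset)
  moreover have "coprime a d" using assms(3) coprime_iff_gcd_eq_1 by blast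
  ultimately show False using dirichlet_infinite_primes[of d a] assms by simp
qed

end
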